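(* Let $D<n$ be positive integers, such that $D\in\omega(\log^2 n)$. Let $0<\alpha<1/2$ be a constant and let $\tau=\lfloor\alpha D\rfloor$. Let $\mathcal T$ be the class of trees $T$ with size $\Theta(n)$, diameter $D$, and $\xi(T)\le\tau$. The minimum size of advice to perform leader election in time $\tau$ for the class $\mathcal T$ is $\Theta(n)$.
   Context: Trees are finite, undirected and anonymous (nodes have no labels), and are port-numbered: at each node $v$ of degree $d$ the incident edges carry distinct port numbers from $\{0,\dots,d-1\}$; there is no relation between the two port numbers of an edge at its two endpoints. The size of a tree is its number of nodes. Leader election in $T$: every node $v$ must output a finite sequence $P(v)=(p_1,\dots,p_k)$ of nonnegative integers (possibly empty). Let $P^*(v)$ be the path starting at $v$ obtained by taking $p_i$ as the outgoing port at the $i$-th node of the path. All $P^*(v)$ must be simple paths in $T$ ending at one common node (the leader). View: $V_T(v,r)$ is the subtree of $T$ induced by all nodes at distance at most $r$ from $v$, rooted at $v$, with all port numbers at these nodes and with the degrees of all nodes at distance exactly $r$ from $v$ (views are identified up to root- and port-preserving isomorphism). Deterministic algorithm with advice (LOCAL model): an oracle knowing $T$ assigns to $T$ one binary string $A(T)$, given to all nodes at the start; the size of advice for $T$ is the length of $A(T)$. After each round $r\ge 0$, each node $v$ that has not yet halted decides, as a function of $V_T(v,r)$ and $A(T)$ only, whether to halt and what to output. The algorithm works in time $\tau$ on a class if it solves leader election in every tree of the class with all nodes halting in rounds at most $\tau$. The minimum size of advice for a class and time $\tau$ is the minimum, over all such algorithms (and oracles), of the maximum of $|A(T)|$ over trees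 $T$ in the class. $\xi(T)$ is the minimum time in which leader election in $T$ is feasible when each node is given the entire port-numbered map of $T$ (without its own position marked), i.e., the smallest $\tau\ge 0$ for which there is a valid assignment of outputs in $T$ in which the output of each node $v$ depends only on $V_T(v,\tau)$. Asymptotic convention: $D=D(n)$ is a function of $n$ with $D(n)/\log^2 n\to\infty$; "size $\Theta(n)$" means size in $[c_1n,c_2n]$ for suitable constants $0<c_1\le c_2$; the statement holds for all sufficiently large $n$, with implied constants allowed to depend on $\alpha$. *)

theory Defs
  imports Complex_Main "HOL-Library.Extended_Nat" "HOL-Library.Landau_Symbols"
begin

text \<open>
  Node names are natural numbers, used only to write trees down. Nothing an algorithm can
  access depends on them, because views are taken up to isomorphism below.
  The value \<open>port T u v\<close> is the port number at \<open>u\<close> of the edge between \<open>u\<close> and \<open>v\<close>;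
  it is irrelevant when \<open>u\<close> and \<open>v\<close> are not adjacent.
\<close>

record ptree =
  nodes :: "nat set"
  edges :: "nat set set"
  port :: "nat \<Rightarrow> nat \<Rightarrow> nat"

definition neighbours :: "('a) ptree_scheme \<Rightarrow> nat \<Rightarrow> nat set" where
  "neighbours T u = {v. {u, v} \<in> edges T}"

definition degree :: "('a) ptree_scheme \<Rightarrow> nat \<Rightarrow> nat" where
  "degree T u = card (neighbours T u)"

definition walk :: "('a) ptree_scheme \<Rightarrow> nat list \<Rightarrow> bool" where
  "walk T xs \<longleftrightarrow> xs \<noteq> [] \<and> set xs \<subseteq> nodes T \<and>
     (\<forall>i. Suc i < length xs \<longrightarrow> {xs ! i, xs ! Suc i} \<in> edges T)"

definition simple_path :: "('a) ptree_scheme \<Rightarrow> nat list \<Rightarrow> bool" where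
  "simple_path T xs \<longleftrightarrow> walk T xs \<and> distinct xs"

definition cycle :: "('a) ptree_scheme \<Rightarrow> nat list \<Rightarrow> bool" where
  "cycle T xs \<longleftrightarrow> simple_path T xs \<and> 3 \<le> length xs \<and> {last xs, hd xs} \<in> edges T"

definition is_tree :: "('a) ptree_scheme \<Rightarrow> bool" where
  "is_tree T \<longleftrightarrow>
     finite (nodes T) \<and> nodes T \<noteq> {} \<and>
     (\<forall>e\<in>edges T. e \<subseteq> nodes T \<and> card e = 2) \<and>
     (\<forall>u\<in>nodes T. \<forall>v\<in>nodes T. \<exists>xs. walk T xs \<and> hd xs = u \<and> last xs = v) \<and>
     (\<nexists>xs. cycle T xs)"

definition port_numbered_tree :: "('a) ptree_scheme \<Rightarrow> bool" where
  "port_numbered_tree T \<longleftrightarrow> is_tree T \<and>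
     (\<forall>u\<in>nodes T. inj_on (port T u) (neighbours T u) \<and>
                  port T u ` neighbours T u \<subseteq> {0..<degree T u})"

definition distance :: "('a) ptree_scheme \<Rightarrow> nat \<Rightarrow> nat \<Rightarrow> nat" where
  "distance T u v = (LEAST k. \<exists>xs. walk T xs \<and> hd xs = u \<and> last xs = v \<and> length xs = Suc k)"

definition diameter :: "('a) ptree_scheme \<Rightarrow> nat" where
  "diameter T = Max {distance T u v | u v. u \<in> nodes T \<and> v \<in> nodes T}"

definition follows :: "('a) ptree_scheme \<Rightarrow> nat \<Rightarrow> nat list \<Rightarrow> nat list \<Rightarrow> bool" where
  "follows T v ps xs \<longleftrightarrow> walk T xs \<and> hd xs = v \<and> length xs = Suc (length ps) \<and>
     (\<forall>i < length ps. port T (xs ! i) (xs ! Suc i) = ps ! i)"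

definition elects_leader :: "('a) ptree_scheme \<Rightarrow> (nat \<Rightarrow> nat list) \<Rightarrow> bool" where
  "elects_leader T P \<longleftrightarrow>
     (\<exists>l\<in>nodes T. \<forall>v\<in>nodes T. \<exists>xs. follows T v (P v) xs \<and> simple_path T xs \<and> last xs = l)"

text \<open>
  A view is a rooted port-numbered tree in which \<open>bdeg\<close> carries the degree, in the original
  tree, of each node at distance exactly \<open>r\<close> from the root, and \<open>None\<close> at closer nodes.
\<close>

record pview = ptree +
  vroot :: nat
  bdeg :: "nat \<Rightarrow> nat option"

definition local_view :: "ptree \<Rightarrow> nat \<Rightarrow> nat \<Rightarrow> pview" where
  "local_view T v r =
     (let B = {u \<in> nodes T. distance T v u \<le> r} in
      \<lparr>nodes = B,
       edges = {e \<in> edges T. e \<subseteq> B},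
       port = port T,
       vroot = v,
       bdeg = (\<lambda>u. if distance T v u = r then Some (degree T u) else None)\<rparr>)"

definition view_iso :: "pview \<Rightarrow> pview \<Rightarrow> bool" where
  "view_iso V W \<longleftrightarrow> (\<exists>\<phi>. bij_betw \<phi> (nodes V) (nodes W) \<and> \<phi> (vroot V) = vroot W \<and>
     (\<forall>u\<in>nodes V. bdeg W (\<phi> u) = bdeg V u) \<and>
     (\<forall>u\<in>nodes V. \<forall>v\<in>nodes V.
        ({u, v} \<in> edges V \<longleftrightarrow> {\<phi> u, \<phi> v} \<in> edges W) \<and>
        ({u, v} \<in> edges V \<longrightarrow> port W (\<phi> u) (\<phi> v) = port V u v)))"

text \<open>Views up to isomorphism, represented by their isomorphism classes.\<close>

definition view :: "ptree \<Rightarrow> nat \<Rightarrow> nat \<Rightarrow> pview set" where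
  "view T v r = {W. view_iso W (local_view T v r)}"

lemma view_iso_refl: "view_iso V V"
  unfolding view_iso_def by (rule exI[of _ id]) auto

lemma view_iso_trans:
  assumes "view_iso U V" "view_iso V W"
  shows "view_iso U W"
proof -
  obtain f where f: "bij_betw f (nodes U) (nodes V)" "f (vroot U) = vroot V"
    "\<forall>u\<in>nodes U. bdeg V (f u) = bdeg U u"
    "\<forall>u\<in>nodes U. \<forall>v\<in>nodes U. ({u, v} \<in> edges U \<longleftrightarrow> {f u, f v} \<in> edges V) \<and>
        ({u, v} \<in> edges U \<longrightarrow> port V (f u) (f v) = port U u v)"
    using assms(1) unfolding view_iso_def by blast
  obtain g where g: "bij_betw g (nodes V) (nodes W)" "g (vroot V) = vroot W"
    "\<forall>u\<in>nodes V. bdeg W (g u) = bdeg V u"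
    "\<forall>u\<in>nodes V. \<forall>v\<in>nodes V. ({u, v} \<in> edges V \<longleftrightarrow> {g u, g v} \<in> edges W) \<and>
        ({u, v} \<in> edges V \<longrightarrow> port W (g u) (g v) = port V u v)"
    using assms(2) unfolding view_iso_def by blast
  have m: "\<And>u. u \<in> nodes U \<Longrightarrow> f u \<in> nodes V"
    using f(1) by (auto simp: bij_betw_def)
  show ?thesis
    unfolding view_iso_def
    by (rule exI[of _ "g \<circ> f"]) (use f g m bij_betw_trans[OF f(1) g(1)] in simp)
qed

lemma view_iso_sym:
  assumes "view_iso V W" "vroot V \<in> nodes V"
  shows "view_iso W V"
proof -
  obtain f where f: "bij_betw f (nodes V) (nodes W)" "f (vroot V) = vroot W"
    "\<forall>u\<in>nodes V. bdeg W (f u) = bdeg V u"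
    "\<forall>u\<in>nodes V. \<forall>v\<in>nodes V. ({u, v} \<in> edges V \<longleftrightarrow> {f u, f v} \<in> edges W) \<and>
        ({u, v} \<in> edges V \<longrightarrow> port W (f u) (f v) = port V u v)"
    using assms(1) unfolding view_iso_def by blast
  define g where "g = inv_into (nodes V) f"
  have b: "bij_betw g (nodes W) (nodes V)"
    unfolding g_def by (rule bij_betw_inv_into[OF f(1)])
  have m: "\<And>w. w \<in> nodes W \<Longrightarrow> g w \<in> nodes V"
    using b by (auto simp: bij_betw_def)
  have i: "\<And>w. w \<in> nodes W \<Longrightarrow> f (g w) = w"
    unfolding g_def by (rule bij_betw_inv_into_right[OF f(1)])
  have r: "g (vroot W) = vroot V"
    unfolding g_def f(2)[symmetric] by (rule bij_betw_inv_into_left[OF f(1) assms(2)])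
  have d: "bdeg V (g w) = bdeg W w" if "w \<in> nodes W" for w
    using f(3) m[OF that] i[OF that] by force
  have e: "({u, v} \<in> edges W \<longleftrightarrow> {g u, g v} \<in> edges V) \<and>
        ({u, v} \<in> edges W \<longrightarrow> port V (g u) (g v) = port W u v)"
    if "u \<in> nodes W" "v \<in> nodes W" for u v
    using f(4)[rule_format, OF m[OF that(1)] m[OF that(2)]] i that by simp
  show ?thesis
    unfolding view_iso_def by (rule exI[of _ g]) (use b r d e in blast)
qed

lemma view_eq_iff:
  assumes "v \<in> nodes T" "w \<in> nodes S"
  shows "view T v r = view S w s \<longleftrightarrow> view_iso (local_view T v r) (local_view S w s)"
proof -
  have root: "vroot (local_view X x q) \<in> nodes (local_view X x q)" if "x \<in> nodes X" for X x q
  proof -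
    have "\<exists>xs. walk X xs \<and> hd xs = x \<and> last xs = x \<and> length xs = Suc 0"
      by (rule exI[of _ "[x]"]) (use that in \<open>simp add: walk_def\<close>)
    then have "distance X x x = 0"
      unfolding distance_def by (intro Least_eq_0)
    then show ?thesis
      using that by (simp add: local_view_def Let_def)
  qed
  show ?thesis
    using view_iso_refl view_iso_trans view_iso_sym root assms
    unfolding view_def by blast
qed

text \<open>The infimum of the empty set is \<open>\<infinity>\<close>: the value when election is infeasible even with a map.\<close>

definition xi :: "ptree \<Rightarrow> enat" where
  "xi T = Inf {enat t | t. \<exists>f. elects_leader T (\<lambda>v. f (view T v t))}"

text \<open>\<open>None\<close> means that the node does not halt in the current round.\<close>

type_synonym algorithm = "pview set \<Rightarrow> bool list \<Rightarrow> nat list option"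

type_synonym oracle_fn = "ptree \<Rightarrow> bool list"

definition halts_at :: "algorithm \<Rightarrow> bool list \<Rightarrow> ptree \<Rightarrow> nat \<Rightarrow> nat \<Rightarrow> bool" where
  "halts_at alg a T v r \<longleftrightarrow>
     alg (view T v r) a \<noteq> None \<and> (\<forall>s<r. alg (view T v s) a = None)"

definition elects_within ::
    "algorithm \<Rightarrow> oracle_fn \<Rightarrow> ptree set \<Rightarrow> nat \<Rightarrow> bool" where
  "elects_within alg A \<T> t \<longleftrightarrow>
     (\<forall>T\<in>\<T>. \<exists>h. (\<forall>v\<in>nodes T. halts_at alg (A T) T v (h v) \<and> h v \<le> t) \<and>
               elects_leader T (\<lambda>v. the (alg (view T v (h v)) (A T))))"

definition min_advice :: "ptree set \<Rightarrow> nat \<Rightarrow> enat" where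
  "min_advice \<T> t =
     Inf {(SUP T\<in>\<T>. enat (length (A T))) | alg A. elects_within alg A \<T> t}"

definition tree_class :: "real \<Rightarrow> real \<Rightarrow> nat \<Rightarrow> nat \<Rightarrow> nat \<Rightarrow> ptree set" where
  "tree_class c1 c2 n D t =
     {T. port_numbered_tree T \<and>
         c1 * real n \<le> real (card (nodes T)) \<and> real (card (nodes T)) \<le> c2 * real n \<and>
         diameter T = D \<and> xi T \<le> enat t}"

end

theory Submission
  imports Defs
begin

text \<open>
  Upper bound: a rooted port-numbered tree is an ordered tree in which every node also marks the
  position of the port to its parent, so a tree with \<open>N\<close> nodes is determined up to isomorphism by
  at most \<open>4 * N\<close> bits. Given this map, each node halts as soon as its view is one of the views of
  radius \<open>s \<le> \<tau>\<close> in the map on which leader election with map knowledge depends.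

  Lower bound: take about \<open>n / D\<close> arms of length about \<open>D / 2\<close> meeting in a centre, where a node of
  degree 2 has one free bit: which of its two ports leads to the centre. The end of an arm outside
  the leader's arm has to output the bits along its arm, about \<open>(1/2 - \<alpha>) D\<close> of which lie outside
  its view, so the advice must determine \<open>\<Theta>(n)\<close> free bits. At intervals of about \<open>log n\<close>, short
  paths hang from the arms whose ports spell their position in the tree. They make all views of
  radius \<open>\<tau>\<close> distinct, which gives \<open>\<xi> \<le> \<tau>\<close>.
\<close>

section \<open>Walks and distances\<close>

text \<open>Three obstacles shape the proof. A view does not record its radius, so an algorithm that
  sees only views cannot wait for a prescribed round \<open>s\<close>; a node may recognise one of
  the views of its map too early, and it has to be shown that its output is the right one all the
  same. In the lower bound the leader is chosen by the algorithm and the oracle, so no particular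
  arm can be trusted to spell its bits; this is why every bit vector is repeated on several arms.
  Finally, the hanging paths must be long enough to name a position, frequent enough for every view
  to show a complete one, and yet few enough to keep the size linear in \<open>n\<close>. Making the
  spacing equal to the length \<open>l\<close> settles this: a path is always within distance
  \<open>2 * l\<close>, and the paths of one arm have at most \<open>L\<close> nodes in total. The
  free bits take up only half of the stretch of about \<open>(1/2 - \<alpha>) D\<close> positions
  that an end node cannot see; the other half absorbs additive constants and roundings.\<close>

lemma walk_singleton [simp]: "walk T [x] \<longleftrightarrow> x \<in> nodes T"
  by (auto simp: walk_def)

lemma walk_snoc:
  assumes "xs \<noteq> []"
  shows "walk T (xs @ [v]) \<longleftrightarrow> walk T xs \<and> {last xs, v} \<in> edges T \<and> v \<in> nodes T"
proof
  assume w: "walk T (xs @ [v])"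
  have "{xs ! i, xs ! Suc i} \<in> edges T" if "Suc i < length xs" for i
    using w that by (auto simp: walk_def nth_append dest!: spec[of _ i])
  moreover have "{last xs, v} \<in> edges T"
    using w assms
    by (auto simp: walk_def nth_append last_conv_nth dest!: spec[of _ "length xs - 1"])
  ultimately show "walk T xs \<and> {last xs, v} \<in> edges T \<and> v \<in> nodes T"
    using w assms by (auto simp: walk_def)
next
  assume w: "walk T xs \<and> {last xs, v} \<in> edges T \<and> v \<in> nodes T"
  have "{(xs @ [v]) ! i, (xs @ [v]) ! Suc i} \<in> edges T" if "Suc i < length (xs @ [v])" for i
  proof (cases "Suc i < length xs")
    case True
    then show ?thesis using w by (auto simp: walk_def nth_append)
  next
    case False
    then have "i = length xs - 1" using that by auto
    then show ?thesis using w assms by (auto simp: nth_append last_conv_nth)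
  qed
  then show "walk T (xs @ [v])" using w by (auto simp: walk_def)
qed

lemma walk_prefix:
  assumes "walk T (xs @ ys)" "xs \<noteq> []"
  shows "walk T xs"
  using assms(1)
proof (induction ys rule: rev_induct)
  case (snoc y ys)
  then show ?case
    using assms(2) walk_snoc[of "xs @ ys" T y] by simp
qed simp

text \<open>With the exact length as an argument, walks obey the recursion \<open>reach_Suc\<close>,
  and most later arguments become inductions on \<open>k\<close> that never touch lists.\<close>

definition reach :: "('a) ptree_scheme \<Rightarrow> nat \<Rightarrow> nat \<Rightarrow> nat \<Rightarrow> bool" where
  "reach T u k v \<longleftrightarrow> (\<exists>xs. walk T xs \<and> hd xs = u \<and> last xs = v \<and> length xs = Suc k)"

lemma reach_0 [simp]: "reach T u 0 v \<longleftrightarrow> u = v \<and> u \<in> nodes T"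
  by (auto simp: reach_def length_Suc_conv intro!: exI[of _ "[u]"])

lemma reach_Suc:
  "reach T u (Suc k) v \<longleftrightarrow> (\<exists>w. reach T u k w \<and> {w, v} \<in> edges T \<and> v \<in> nodes T)"
proof
  assume "reach T u (Suc k) v"
  then obtain xs where xs: "walk T xs" "hd xs = u" "last xs = v" "length xs = Suc (Suc k)"
    by (auto simp: reach_def)
  define ys where "ys = butlast xs"
  have "xs \<noteq> []" using xs(4) by auto
  then have e: "xs = ys @ [v]" using xs(3) unfolding ys_def by (metis append_butlast_last_id)
  have l: "length ys = Suc k" using xs(4) e by auto
  then have n: "ys \<noteq> []" by auto
  show "\<exists>w. reach T u k w \<and> {w, v} \<in> edges T \<and> v \<in> nodes T"
    using xs(1,2) walk_snoc[OF n, of T v] l n unfolding e reach_def by auto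
next
  assume "\<exists>w. reach T u k w \<and> {w, v} \<in> edges T \<and> v \<in> nodes T"
  then obtain xs where xs: "walk T xs" "hd xs = u" "{last xs, v} \<in> edges T" "v \<in> nodes T"
    "length xs = Suc k"
    by (auto simp: reach_def)
  then have n: "xs \<noteq> []" by auto
  show "reach T u (Suc k) v"
    unfolding reach_def by (rule exI[of _ "xs @ [v]"]) (use xs n walk_snoc[OF n] in auto)
qed

lemma reach_nodes:
  assumes "reach T u k v"
  shows "u \<in> nodes T" "v \<in> nodes T"
proof -
  show "v \<in> nodes T" using assms by (cases k) (auto simp: reach_Suc)
  show "u \<in> nodes T" using assms by (induction k arbitrary: v) (auto simp: reach_Suc)
qed

lemma reach_edge: "{u, v} \<in> edges T \<Longrightarrow> u \<in> nodes T \<Longrightarrow> v \<in> nodes T \<Longrightarrow> reach T u 1 v"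
  by (auto simp: reach_Suc)

lemma reach_trans:
  assumes "reach T u k v" "reach T v m w"
  shows "reach T u (k + m) w"
  using assms(2)
proof (induction m arbitrary: w)
  case 0
  then show ?case using assms(1) by auto
next
  case (Suc m)
  then show ?case by (auto simp: reach_Suc)
qed

lemma reach_sym: "reach T u k v \<Longrightarrow> reach T v k u"
proof (induction k arbitrary: v)
  case (Suc k)
  then obtain w where w: "reach T u k w" "{w, v} \<in> edges T" "v \<in> nodes T"
    by (auto simp: reach_Suc)
  have "reach T v 1 w"
    using w reach_nodes[OF w(1)] by (intro reach_edge) (auto simp: insert_commute)
  from reach_trans[OF this Suc.IH[OF w(1)]] show ?case by simp
qed auto

text \<open>Extending a simple path by an edge either keeps it simple or returns to one of its
  nodes, and then the path is cut off at that node.\<close>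

lemma reach_simple:
  assumes "reach T u k v"
  shows "\<exists>xs. simple_path T xs \<and> hd xs = u \<and> last xs = v"
  using assms
proof (induction k arbitrary: v)
  case 0
  then show ?case by (auto simp: simple_path_def intro!: exI[of _ "[u]"])
next
  case (Suc k)
  then obtain w where w: "reach T u k w" "{w, v} \<in> edges T" "v \<in> nodes T"
    by (auto simp: reach_Suc)
  then obtain xs where xs: "simple_path T xs" "hd xs = u" "last xs = w"
    using Suc.IH by blast
  then have n: "xs \<noteq> []" by (auto simp: simple_path_def walk_def)
  show ?case
  proof (cases "v \<in> set xs")
    case True
    then obtain as bs where e: "xs = as @ v # bs" by (meson split_list)
    show ?thesis
    proof (intro exI conjI)
      have "xs = (as @ [v]) @ bs" using e by simp
      then have "walk T (as @ [v])"
        using xs(1) walk_prefix[of T "as @ [v]" bs] by (auto simp: simple_path_def)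
      then show "simple_path T (as @ [v])" using xs(1) e by (auto simp: simple_path_def)
      show "hd (as @ [v]) = u" using xs(2) e by (cases as) auto
    qed simp
  next
    case False
    then show ?thesis
      using xs n w walk_snoc[OF n, of T v]
      by (intro exI[of _ "xs @ [v]"]) (auto simp: simple_path_def)
  qed
qed

section \<open>Distances in trees\<close>

lemma distance_LEAST: "distance T u v = (LEAST k. reach T u k v)"
  by (simp add: distance_def reach_def)

lemma distance_le: "reach T u k v \<Longrightarrow> distance T u v \<le> k"
  unfolding distance_LEAST by (rule Least_le)

lemma distance_self [simp]: "u \<in> nodes T \<Longrightarrow> distance T u u = 0"
  using distance_le[of T u 0 u] by simp

lemma is_tree_edgeD:
  assumes "is_tree T" "{u, v} \<in> edges T"
  shows "u \<in> nodes T" "v \<in> nodes T" "u \<noteq> v"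
proof -
  have "\<forall>e\<in>edges T. e \<subseteq> nodes T \<and> card e = 2"
    using assms(1) by (simp add: is_tree_def)
  from bspec[OF this assms(2)] have "{u, v} \<subseteq> nodes T" "card {u, v} = 2"
    by simp_all
  then show "u \<in> nodes T" "v \<in> nodes T" "u \<noteq> v" by auto
qed

lemma is_tree_reach:
  assumes "is_tree T" "u \<in> nodes T" "v \<in> nodes T"
  shows "reach T u (distance T u v) v"
proof -
  have "\<forall>u\<in>nodes T. \<forall>v\<in>nodes T. \<exists>xs. walk T xs \<and> hd xs = u \<and> last xs = v"
    using assms(1) by (simp add: is_tree_def)
  then obtain xs where xs: "walk T xs" "hd xs = u" "last xs = v"
    using assms(2,3) by blast
  then have "reach T u (length xs - 1) v"
    unfolding reach_def by (intro exI[of _ xs]) (auto simp: walk_def)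
  then show ?thesis unfolding distance_LEAST by (rule LeastI)
qed

lemma distance_pred:
  assumes "is_tree T" "u \<in> nodes T" "v \<in> nodes T" "distance T u v = Suc k"
  obtains w where "{w, v} \<in> edges T" "distance T u w = k" "reach T u k w"
proof -
  have "reach T u (Suc k) v" using is_tree_reach[OF assms(1-3)] assms(4) by simp
  then obtain w where w: "reach T u k w" "{w, v} \<in> edges T" by (auto simp: reach_Suc)
  have "distance T u w \<le> k" using w(1) by (rule distance_le)
  moreover have "distance T u v \<le> Suc (distance T u w)"
    using is_tree_reach[OF assms(1,2) reach_nodes(2)[OF w(1)]] w(2) assms(3)
    by (intro distance_le) (auto simp: reach_Suc)
  ultimately have "distance T u w = k" using assms(4) by simp
  then show ?thesis using w that by blast
qed

text \<open>Distances drop by one per step along a shortest walk, so no value is skipped. The use is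
  by contraposition: if no node is at distance exactly \<open>s\<close>, then all nodes are
  closer.\<close>

lemma distance_ivt:
  assumes "is_tree T" "u \<in> nodes T" "v \<in> nodes T" "s \<le> distance T u v"
  shows "\<exists>y\<in>nodes T. distance T u y = s"
  using assms(3,4)
proof (induction "distance T u v - s" arbitrary: v)
  case 0
  then show ?case by (intro bexI[of _ v]) auto
next
  case (Suc x)
  then obtain k where k: "distance T u v = Suc k" by (cases "distance T u v") auto
  obtain w where w: "{w, v} \<in> edges T" "distance T u w = k"
    using distance_pred[OF assms(1,2) Suc.prems(1) k] by blast
  show ?case
    using Suc.hyps(1)[of w] is_tree_edgeD(1)[OF assms(1) w(1)] w(2) k Suc.hyps(2) Suc.prems(2)
    by simp
qed

lemma distance_triangle:
  assumes "is_tree T" "u \<in> nodes T" "v \<in> nodes T" "w \<in> nodes T"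
  shows "distance T u w \<le> distance T u v + distance T v w"
  by (intro distance_le reach_trans[OF is_tree_reach is_tree_reach] assms)

text \<open>The source of lower bounds on distances: a function that varies by at most 1 along every
  edge certifies one.\<close>

lemma reach_lipschitz:
  fixes g :: "nat \<Rightarrow> int"
  assumes "\<And>u v. {u, v} \<in> edges T \<Longrightarrow> \<bar>g u - g v\<bar> \<le> 1" "reach T u k v"
  shows "\<bar>g u - g v\<bar> \<le> int k"
  using assms(2)
proof (induction k arbitrary: v)
  case (Suc k)
  then obtain w where w: "reach T u k w" "{w, v} \<in> edges T" by (auto simp: reach_Suc)
  show ?case using Suc.IH[OF w(1)] assms(1)[OF w(2)] by auto
qed auto

text \<open>Shortest walks from \<open>r\<close> to two such neighbours avoid \<open>v\<close>, so two different ones would lie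
  on a cycle through \<open>v\<close>.\<close>

lemma low_neighbour_unique:
  assumes T: "is_tree T" and r: "r \<in> nodes T"
    and e1: "{v, u1} \<in> edges T" and d1: "distance T r u1 \<le> distance T r v"
    and e2: "{v, u2} \<in> edges T" and d2: "distance T r u2 \<le> distance T r v"
  shows "u1 = u2"
proof (rule ccontr)
  assume ne: "u1 \<noteq> u2"
  define S where "S = T\<lparr>nodes := nodes T - {v}, edges := {e \<in> edges T. v \<notin> e}\<rparr>"
  have S [simp]: "nodes S = nodes T - {v}" "edges S = {e \<in> edges T. v \<notin> e}"
    by (auto simp: S_def)
  have avoid: "reach S r k u"
    if "u \<in> nodes T" "u \<noteq> v" "distance T r u = k" "k \<le> distance T r v" for k u
    using that
  proof (induction k arbitrary: u)
    case 0
    then show ?case using is_tree_reach[OF T r, of u] by auto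
  next
    case (Suc k)
    obtain w where w: "{w, u} \<in> edges T" "distance T r w = k"
      using distance_pred[OF T r Suc.prems(1,3)] by blast
    have "w \<noteq> v" using w(2) Suc.prems(4) by auto
    then have "reach S r k w"
      using Suc.IH[of w] w is_tree_edgeD[OF T w(1)] Suc.prems by auto
    then show ?case using w \<open>w \<noteq> v\<close> Suc.prems by (auto simp: reach_Suc)
  qed
  note D1 = is_tree_edgeD[OF T e1] and D2 = is_tree_edgeD[OF T e2]
  have "reach S r (distance T r u1) u1" "reach S r (distance T r u2) u2"
    using avoid[of u1] avoid[of u2] D1 D2 d1 d2 by auto
  then have "reach S u1 (distance T r u1 + distance T r u2) u2"
    by (intro reach_trans[OF reach_sym])
  then obtain xs where xs: "simple_path S xs" "hd xs = u1" "last xs = u2"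
    using reach_simple by blast
  then have n: "xs \<noteq> []" by (auto simp: simple_path_def walk_def)
  have l: "2 \<le> length xs"
  proof (rule ccontr)
    assume "\<not> 2 \<le> length xs"
    then obtain x where "xs = [x]" using n by (cases xs) (auto simp: Suc_le_eq)
    then show False using xs ne by simp
  qed
  have w: "walk T (v # xs)"
  proof -
    have "{(v # xs) ! i, (v # xs) ! Suc i} \<in> edges T" if "Suc i < length (v # xs)" for i
    proof (cases i)
      case 0
      then show ?thesis using xs(2) e1 n by (simp add: hd_conv_nth)
    next
      case (Suc m)
      then show ?thesis using xs(1) that by (auto simp: simple_path_def walk_def)
    qed
    then show ?thesis using xs(1) D1 by (auto simp: simple_path_def walk_def)
  qed
  have "v \<notin> set xs" using xs(1) by (auto simp: simple_path_def walk_def)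
  then have "cycle T (v # xs)"
    using xs w l n e2 by (auto simp: cycle_def simple_path_def insert_commute)
  then show False using T by (auto simp: is_tree_def)
qed

section \<open>Encoding port-numbered trees\<close>

datatype rose = Nd "rose list"

primrec rose_size :: "rose \<Rightarrow> nat" where
  "rose_size (Nd ts) = Suc (sum_list (map rose_size ts))"

primrec flat :: "rose \<Rightarrow> bool list" where
  "flat (Nd ts) = True # concat (map flat ts) @ [False]"

lemma length_flat: "length (flat t) = 2 * rose_size t"
proof (induction t)
  case (Nd ts)
  then have "length (concat (map flat ts)) = 2 * sum_list (map rose_size ts)"
    by (induction ts) auto
  then show ?case by simp
qed

text \<open>\<open>flat\<close> writes balanced brackets. Injectivity alone does not pass through
  the concatenation of the children; the version with arbitrary remainders does, because it allows
  the first child to be split off.\<close>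

lemma flat_prefix_free: "flat s @ xs = flat t @ ys \<Longrightarrow> s = t \<and> xs = ys"
proof (induction s arbitrary: t xs ys)
  case (Nd ss)
  obtain ts where t: "t = Nd ts" by (cases t)
  \<comment> \<open>The children are compared list against list. The closing \<open>False\<close>
    ends the parse, since the code of a child starts with \<open>True\<close>.\<close>
  have *: "concat (map flat ss) @ False # xs = concat (map flat us) @ False # ys \<Longrightarrow>
      ss = us \<and> xs = ys" for us
    using Nd.IH
  proof (induction ss arbitrary: us)
    case Nil
    then show ?case
    proof (cases us)
      case (Cons u us')
      obtain vs where "u = Nd vs" by (cases u)
      then show ?thesis using Nil Cons by simp
    qed simp
  next
    case (Cons s ss)
    show ?case
    proof (cases us)
      case Nil
      obtain vs where "s = Nd vs" by (cases s)
      then show ?thesis using Nil Cons by simp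
    next
      case (Cons u us')
      have "flat s @ (concat (map flat ss) @ False # xs) =
            flat u @ (concat (map flat us') @ False # ys)"
        using Cons.prems(1) Cons by simp
      then have "s = u \<and> concat (map flat ss) @ False # xs = concat (map flat us') @ False # ys"
        by (rule Cons.prems(2)[OF list.set_intros(1)])
      moreover have IH: "x \<in> set ss \<Longrightarrow> flat x @ xs = flat t @ ys \<Longrightarrow> x = t \<and> xs = ys"
        for x t xs ys
        by (rule Cons.prems(2)) simp_all
      ultimately show ?thesis using Cons.IH[of us', OF _ IH] \<open>us = u # us'\<close> by blast
    qed
  qed
  from Nd.prems have "concat (map flat ss) @ False # xs = concat (map flat ts) @ False # ys"
    by (simp add: t)
  from *[OF this] show ?case by (simp add: t)
qed

lemma flat_inject: "flat s = flat t \<longleftrightarrow> s = t"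
  using flat_prefix_free[of s "[]" t "[]"] by auto

section \<open>Rooted trees as ordered trees\<close>

locale rooted_tree =
  fixes T :: ptree and r :: nat
  assumes ported: "port_numbered_tree T" and root: "r \<in> nodes T"
begin

lemma tree: "is_tree T"
  using ported by (simp add: port_numbered_tree_def)

lemma finite_nodes: "finite (nodes T)"
  using tree by (simp add: is_tree_def)

lemmas edgeD = is_tree_edgeD[OF tree]

text \<open>An injection of the neighbours into equally many numbers is onto, so every number below
  the degree is a port.\<close>

lemma port_bij:
  assumes "v \<in> nodes T"
  shows "bij_betw (port T v) (neighbours T v) {0..<degree T v}"
proof -
  have i: "inj_on (port T v) (neighbours T v)"
    and s: "port T v ` neighbours T v \<subseteq> {0..<degree T v}"
    using ported assms by (auto simp: port_numbered_tree_def)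
  have "card (port T v ` neighbours T v) = card {0..<degree T v}"
    using card_image[OF i] by (simp add: degree_def)
  then have "port T v ` neighbours T v = {0..<degree T v}"
    using s by (intro card_subset_eq) auto
  then show ?thesis using i by (simp add: bij_betw_def)
qed

definition h :: "nat \<Rightarrow> nat" where
  "h v = distance T r v"

definition par :: "nat \<Rightarrow> nat" where
  "par v = (SOME u. {u, v} \<in> edges T \<and> Suc (h u) = h v)"

definition nb :: "nat \<Rightarrow> nat \<Rightarrow> nat" where
  "nb v i = (SOME w. {v, w} \<in> edges T \<and> port T v w = i)"

lemma h_root [simp]: "h r = 0"
  using root by (simp add: h_def)

lemma h_0: "v \<in> nodes T \<Longrightarrow> h v = 0 \<Longrightarrow> v = r"
  using is_tree_reach[OF tree root, of v] by (simp add: h_def)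

lemma par:
  assumes "v \<in> nodes T" "v \<noteq> r"
  shows "{par v, v} \<in> edges T" "Suc (h (par v)) = h v"
proof -
  obtain k where "h v = Suc k" using assms h_0 by (cases "h v") auto
  then obtain w where "{w, v} \<in> edges T \<and> Suc (h w) = h v"
    using distance_pred[OF tree root assms(1), of k] unfolding h_def by metis
  then have "{par v, v} \<in> edges T \<and> Suc (h (par v)) = h v"
    unfolding par_def by (rule someI)
  then show "{par v, v} \<in> edges T" "Suc (h (par v)) = h v" by auto
qed

lemma par_in: "v \<in> nodes T \<Longrightarrow> v \<noteq> r \<Longrightarrow> par v \<in> nodes T"
  using par(1) edgeD by blast

lemma low_neighbour:
  assumes "{u, v} \<in> edges T" "h v \<le> h u"
  shows "u \<noteq> r \<and> v = par u"
proof -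
  note D = edgeD[OF assms(1)]
  have "u \<noteq> r" using assms(2) D h_0[of v] by auto
  moreover have "v = par u"
    using low_neighbour_unique[OF tree root, of u v "par u"] assms par[OF D(1) \<open>u \<noteq> r\<close>]
    by (simp add: h_def insert_commute)
  ultimately show ?thesis by simp
qed

lemma edge_cases:
  assumes "{u, v} \<in> edges T"
  obtains "u \<noteq> r" "v = par u" "h u = Suc (h v)" | "v \<noteq> r" "u = par v" "h v = Suc (h u)"
proof (cases "h v \<le> h u")
  case True
  then show ?thesis
    using low_neighbour[OF assms True] par(2) edgeD[OF assms] that(1) by auto
next
  case False
  have "{v, u} \<in> edges T" using assms by (simp add: insert_commute)
  from low_neighbour[OF this] show ?thesis
    using False par(2) edgeD[OF assms] that(2) by auto
qed

lemma nb:
  assumes "v \<in> nodes T" "i < degree T v"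
  shows "{v, nb v i} \<in> edges T" "port T v (nb v i) = i"
proof -
  have "i \<in> port T v ` neighbours T v"
    using port_bij[OF assms(1)] assms(2) by (auto simp: bij_betw_def)
  then have "\<exists>w. {v, w} \<in> edges T \<and> port T v w = i" by (auto simp: neighbours_def)
  then have "{v, nb v i} \<in> edges T \<and> port T v (nb v i) = i"
    unfolding nb_def by (rule someI_ex)
  then show "{v, nb v i} \<in> edges T" "port T v (nb v i) = i" by auto
qed

lemma port_less:
  assumes "{v, w} \<in> edges T"
  shows "port T v w < degree T v"
proof -
  have "port T v w \<in> port T v ` neighbours T v" using assms by (auto simp: neighbours_def)
  then show ?thesis using port_bij[of v] edgeD[OF assms] by (auto simp: bij_betw_def)
qed

lemma port_inj:
  assumes "{v, w} \<in> edges T" "{v, w'} \<in> edges T" "port T v w = port T v w'"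
  shows "w = w'"
  using port_bij[OF edgeD(1)[OF assms(1)]] assms
  by (auto simp: bij_betw_def neighbours_def dest: inj_onD)

lemma nb_port:
  assumes "{v, w} \<in> edges T"
  shows "nb v (port T v w) = w"
  using port_inj[OF _ assms] nb[OF edgeD(1)[OF assms] port_less[OF assms]] by blast

definition is_up :: "nat \<Rightarrow> nat \<Rightarrow> bool" where
  "is_up v i \<longleftrightarrow> v \<noteq> r \<and> nb v i = par v"

text \<open>The tree is a graph on numbers, so the descent to the children is not structural; the
  fuel bounds the remaining depth. \<open>rose\<close> supplies enough of it for the recursion
  \<open>rose_eq\<close> to hold at every node.\<close>

primrec rose_fuel :: "nat \<Rightarrow> nat \<Rightarrow> rose" where
  "rose_fuel 0 v = Nd []"
| "rose_fuel (Suc k) v =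
     Nd (map (\<lambda>i. if is_up v i then Nd [] else rose_fuel k (nb v i)) [0..<degree T v])"

definition height :: nat where
  "height = Suc (Max (h ` nodes T))"

definition rose :: "nat \<Rightarrow> rose" where
  "rose v = rose_fuel (height - h v) v"

lemma h_less_height: "v \<in> nodes T \<Longrightarrow> h v < height"
  using finite_nodes by (simp add: height_def less_Suc_eq_le)

text \<open>The subtree below \<open>v\<close> as an ordered tree, children in port order. The port to the parent is
  marked by \<open>Nd []\<close>, which no child has since its parent is one of its neighbours.\<close>

lemma rose_eq:
  assumes "v \<in> nodes T"
  shows "rose v =
    Nd (map (\<lambda>i. if is_up v i then Nd [] else rose (nb v i)) [0..<degree T v])"
proof -
  have k: "height - h v = Suc (height - Suc (h v))"
    using h_less_height[OF assms] by simp
  have "rose_fuel (height - Suc (h v)) (nb v i) = rose (nb v i)"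
    if "i < degree T v" "\<not> is_up v i" for i
    using nb(1)[OF assms that(1)] that(2)
    by (cases rule: edge_cases) (auto simp: is_up_def rose_def)
  then show ?thesis unfolding rose_def k by simp
qed

lemma rose_nonempty:
  assumes "v \<in> nodes T" "v \<noteq> r"
  shows "rose v \<noteq> Nd []"
proof -
  have "{v, par v} \<in> edges T" using par(1)[OF assms] by (simp add: insert_commute)
  then have "0 < degree T v" using port_less by force
  then show ?thesis by (simp add: rose_eq[OF assms(1)])
qed

text \<open>The 2 counts the node itself and the leaf that marks the port to its parent.\<close>

lemma rose_size_le:
  assumes "v \<in> nodes T"
  shows "rose_size (rose v) \<le> 2 + (\<Sum>w | w \<in> nodes T - {r} \<and> par w = v. rose_size (rose w))"
proof -
  define f where "f w = (if v \<noteq> r \<and> w = par v then 1 else rose_size (rose w))" for w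
  let ?C = "{w. w \<in> nodes T - {r} \<and> par w = v}"
  have fin: "finite ?C" using finite_nodes by simp
  define P where "P = (if v = r then {} else {par v})"
  have finP: "finite P" by (simp add: P_def)
  have e: "map rose_size (map (\<lambda>i. if is_up v i then Nd [] else rose (nb v i)) [0..<degree T v]) =
        map (\<lambda>i. f (nb v i)) [0..<degree T v]"
    by (simp add: is_up_def f_def)
  have "rose_size (rose v) = Suc (sum_list (map (\<lambda>i. f (nb v i)) [0..<degree T v]))"
    by (subst rose_eq[OF assms], subst rose_size.simps, subst e) (rule refl)
  moreover have "sum_list (map (\<lambda>i. f (nb v i)) [0..<degree T v]) =
      (\<Sum>i\<in>{0..<degree T v}. f (nb v i))"
    by (simp only: interv_sum_list_conv_sum_set_nat set_upt)
  moreover have "\<dots> = (\<Sum>w\<in>neighbours T v. f (nb v (port T v w)))"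
    by (rule sum.reindex_bij_betw[OF port_bij[OF assms], symmetric])
  moreover have "\<dots> = (\<Sum>w\<in>neighbours T v. f w)"
  proof (rule sum.cong)
    fix w assume "w \<in> neighbours T v"
    then have "nb v (port T v w) = w" by (simp add: neighbours_def nb_port)
    then show "f (nb v (port T v w)) = f w" by simp
  qed simp
  moreover have "(\<Sum>w\<in>neighbours T v. f w) \<le> (\<Sum>w\<in>?C \<union> P. f w)"
  proof (rule sum_mono2)
    show "neighbours T v \<subseteq> ?C \<union> P"
    proof
      fix w assume "w \<in> neighbours T v"
      then have e: "{v, w} \<in> edges T" by (simp add: neighbours_def)
      have "w \<in> nodes T" using edgeD[OF e] by simp
      then show "w \<in> ?C \<union> P"
        by (cases rule: edge_cases[OF e]) (simp_all add: P_def)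
    qed
  qed (use fin finP in simp_all)
  moreover have "(\<Sum>w\<in>?C \<union> P. f w) \<le> (\<Sum>w\<in>?C. f w) + (\<Sum>w\<in>P. f w)"
    using sum.union_inter[OF fin finP, of f] by linarith
  moreover have "(\<Sum>w\<in>P. f w) \<le> 1" by (simp add: P_def f_def)
  moreover have "(\<Sum>w\<in>?C. f w) = (\<Sum>w\<in>?C. rose_size (rose w))"
  proof (rule sum.cong)
    fix w assume w: "w \<in> ?C"
    have "\<not> (v \<noteq> r \<and> w = par v)" using w par(2)[of w] par(2)[OF assms] by auto
    then show "f w = rose_size (rose w)" by (simp only: f_def if_False)
  qed simp
  ultimately show ?thesis by linarith
qed

text \<open>The levels are added from the deepest upwards: the children of one level form exactly
  the level below it, so \<open>rose_size_le\<close> charges 2 to each node.\<close>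

lemma rose_size_level:
  "k \<le> height \<Longrightarrow> (\<Sum>v | v \<in> nodes T \<and> h v = height - k. rose_size (rose v)) \<le>
     2 * card {v \<in> nodes T. height - k \<le> h v}"
proof (induction k)
  case 0
  have "{v. v \<in> nodes T \<and> h v = height} = {}" using h_less_height by force
  then have "(\<Sum>v | v \<in> nodes T \<and> h v = height. rose_size (rose v)) = 0"
    by (simp only: sum.empty)
  then show ?case by simp
next
  case (Suc k)
  define d where "d = height - Suc k"
  have d: "height - k = Suc d" using Suc.prems by (simp add: d_def)
  let ?L = "{v \<in> nodes T. h v = d}" and ?L' = "{v \<in> nodes T. h v = Suc d}"
  have fin: "finite ?L" "finite ?L'" using finite_nodes by auto
  have lev: "w \<in> nodes T - {r} \<and> par w = v \<longleftrightarrow> w \<in> ?L' \<and> par w = v" if "v \<in> ?L" for v w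
  proof (cases "w \<in> nodes T \<and> w \<noteq> r")
    case True
    then show ?thesis using par(2)[of w] that by auto
  next
    case False
    then show ?thesis by auto
  qed
  have sub: "par ` ?L' \<subseteq> ?L"
  proof (rule image_subsetI)
    fix w assume w: "w \<in> ?L'"
    then have "w \<in> nodes T" "w \<noteq> r" by auto
    then show "par w \<in> ?L" using par(2)[of w] par_in[of w] w by simp
  qed
  have "(\<Sum>v\<in>?L. rose_size (rose v)) \<le>
        (\<Sum>v\<in>?L. 2 + (\<Sum>w | w \<in> nodes T - {r} \<and> par w = v. rose_size (rose w)))"
    using rose_size_le by (intro sum_mono) auto
  also have "\<dots> = 2 * card ?L +
        (\<Sum>v\<in>?L. \<Sum>w | w \<in> nodes T - {r} \<and> par w = v. rose_size (rose w))"
    by (subst sum.distrib) (simp add: mult.commute)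
  also have "(\<Sum>v\<in>?L. \<Sum>w | w \<in> nodes T - {r} \<and> par w = v. rose_size (rose w)) =
             (\<Sum>v\<in>?L. \<Sum>w | w \<in> ?L' \<and> par w = v. rose_size (rose w))"
    by (rule sum.cong[OF refl]) (simp only: lev)
  also have "\<dots> = (\<Sum>w\<in>?L'. rose_size (rose w))"
    using sum.group[OF fin(2,1) sub] by simp
  also have "\<dots> \<le> 2 * card {v \<in> nodes T. Suc d \<le> h v}"
    using Suc.IH Suc.prems d by simp
  also have "2 * card ?L + 2 * card {v \<in> nodes T. Suc d \<le> h v} =
      2 * card (?L \<union> {v \<in> nodes T. Suc d \<le> h v})"
    using finite_nodes by (subst card_Un_disjoint) auto
  also have "?L \<union> {v \<in> nodes T. Suc d \<le> h v} = {v \<in> nodes T. d \<le> h v}" by auto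
  finally show ?case by (simp add: d_def)
qed

lemma rose_size_root: "rose_size (rose r) \<le> 2 * card (nodes T)"
proof -
  have "{v. v \<in> nodes T \<and> h v = height - height} = {r}" using root h_0 by auto
  then show ?thesis using rose_size_level[of height] by simp
qed

end

definition tree_iso :: "(nat \<Rightarrow> nat) \<Rightarrow> ptree \<Rightarrow> ptree \<Rightarrow> bool" where
  "tree_iso \<phi> T T' \<longleftrightarrow> bij_betw \<phi> (nodes T) (nodes T') \<and>
     (\<forall>u\<in>nodes T. \<forall>v\<in>nodes T.
        ({u, v} \<in> edges T \<longleftrightarrow> {\<phi> u, \<phi> v} \<in> edges T') \<and>
        ({u, v} \<in> edges T \<longrightarrow> port T' (\<phi> u) (\<phi> v) = port T u v))"

section \<open>Equal ordered trees come from isomorphic trees\<close>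

locale rooted_tree_pair = A: rooted_tree T r + B: rooted_tree T' r' for T r T' r' +
  assumes rose_root: "A.rose r = B.rose r'"
begin

lemma rose_cong:
  assumes "v \<in> nodes T" "v' \<in> nodes T'" "A.rose v = B.rose v'"
  shows "degree T v = degree T' v'"
    and "i < degree T v \<Longrightarrow> A.is_up v i \<longleftrightarrow> B.is_up v' i"
    and "i < degree T v \<Longrightarrow> \<not> A.is_up v i \<Longrightarrow> A.rose (A.nb v i) = B.rose (B.nb v' i)"
proof -
  let ?f = "\<lambda>i. if A.is_up v i then Nd [] else A.rose (A.nb v i)"
  let ?g = "\<lambda>i. if B.is_up v' i then Nd [] else B.rose (B.nb v' i)"
  have e: "map ?f [0..<degree T v] = map ?g [0..<degree T' v']"
    using assms(3) A.rose_eq[OF assms(1)] B.rose_eq[OF assms(2)] by simp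
  then show d: "degree T v = degree T' v'"
    using map_eq_imp_length_eq by fastforce
  assume i: "i < degree T v"
  have "\<forall>i\<in>set [0..<degree T v]. ?f i = ?g i"
    using e unfolding d[symmetric] map_eq_conv .
  then have fg: "?f i = ?g i" using i by simp
  have a: "A.rose (A.nb v i) \<noteq> Nd []" if "\<not> A.is_up v i"
    using A.nb(1)[OF assms(1) i]
  proof (cases rule: A.edge_cases)
    case 1
    then show ?thesis using that by (simp add: A.is_up_def)
  next
    case 2
    then show ?thesis using A.rose_nonempty A.edgeD(2)[OF A.nb(1)[OF assms(1) i]] by blast
  qed
  have i': "i < degree T' v'" using i d by simp
  have b: "B.rose (B.nb v' i) \<noteq> Nd []" if "\<not> B.is_up v' i"
    using B.nb(1)[OF assms(2) i']
  proof (cases rule: B.edge_cases)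
    case 1
    then show ?thesis using that by (simp add: B.is_up_def)
  next
    case 2
    then show ?thesis using B.rose_nonempty B.edgeD(2)[OF B.nb(1)[OF assms(2) i']] by blast
  qed
  show up: "A.is_up v i \<longleftrightarrow> B.is_up v' i"
    using fg a b by (auto split: if_splits)
  show "A.rose (A.nb v i) = B.rose (B.nb v' i)" if "\<not> A.is_up v i"
    using fg up that by simp
qed

text \<open>The image of a node is found from the image of its parent, through the port with the
  same number; the first argument is the level of the node.\<close>

primrec iso_level :: "nat \<Rightarrow> nat \<Rightarrow> nat" where
  "iso_level 0 v = r'"
| "iso_level (Suc k) v = B.nb (iso_level k (A.par v)) (port T (A.par v) v)"

definition iso :: "nat \<Rightarrow> nat" where
  "iso v = iso_level (A.h v) v"

text \<open>Equality of the subtrees drives the induction: by \<open>rose_cong\<close> it hands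
  degrees, parent marks and the subtrees of the children on to the next level.\<close>

lemma iso_inv:
  "v \<in> nodes T \<Longrightarrow> iso v \<in> nodes T' \<and> B.h (iso v) = A.h v \<and> A.rose v = B.rose (iso v) \<and>
    (v \<noteq> r \<longrightarrow> iso v \<noteq> r' \<and> B.par (iso v) = iso (A.par v) \<and>
      port T' (iso (A.par v)) (iso v) = port T (A.par v) v)"
proof (induction "A.h v" arbitrary: v)
  case 0
  then have "v = r" using A.h_0 by simp
  then show ?case using rose_root B.root by (simp add: iso_def)
next
  case (Suc k)
  then have nr: "v \<noteq> r" by auto
  define u where "u = A.par v"
  have e: "{u, v} \<in> edges T" and hu: "A.h u = k"
    using A.par[OF Suc.prems nr] Suc.hyps(2) by (auto simp: u_def)
  have uV: "u \<in> nodes T" using A.edgeD[OF e] by simp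
  define i where "i = port T u v"
  have IH: "iso u \<in> nodes T'" "B.h (iso u) = k" "A.rose u = B.rose (iso u)"
    using Suc.hyps(1)[of u] hu uV by auto
  have i: "i < degree T u" using A.port_less[OF e] by (simp add: i_def)
  have nbi: "A.nb u i = v" using A.nb_port[OF e] by (simp add: i_def)
  have nu: "\<not> A.is_up u i"
    using A.par(2)[of u] hu Suc.hyps(2) uV by (auto simp: A.is_up_def nbi)
  have phi: "iso v = B.nb (iso u) i"
    using Suc.hyps(2) hu by (simp add: iso_def i_def u_def flip: Suc.hyps(2))
  note C = rose_cong[OF uV IH(1) IH(3)]
  have i': "i < degree T' (iso u)" using C(1) i by simp
  have e': "{iso u, iso v} \<in> edges T'" "port T' (iso u) (iso v) = i"
    unfolding phi using B.nb[OF IH(1) i'] by auto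
  have nu': "\<not> B.is_up (iso u) i" using C(2)[OF i] nu by simp
  have r: "A.rose v = B.rose (iso v)" using C(3)[OF i nu] nbi phi by simp
  show ?case
    using e'(1)
  proof (cases rule: B.edge_cases)
    case 1
    then show ?thesis using nu' phi by (simp add: B.is_up_def)
  next
    case 2
    then show ?thesis
      using e' IH Suc.hyps(2) r B.edgeD[OF e'(1)] by (simp add: u_def i_def)
  qed
qed

text \<open>Ports towards the parent do not enter the construction of \<open>iso\<close>. They agree
  because the parent marks stand at the same index in equal ordered trees.\<close>

lemma iso_up_port:
  assumes "v \<in> nodes T" "v \<noteq> r"
  shows "port T' (iso v) (iso (A.par v)) = port T v (A.par v)"
proof -
  note I = iso_inv[OF assms(1)]
  have e: "{v, A.par v} \<in> edges T" using A.par(1)[OF assms] by (simp add: insert_commute)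
  define i where "i = port T v (A.par v)"
  have i: "i < degree T v" using A.port_less[OF e] by (simp add: i_def)
  have "A.is_up v i" using A.nb_port[OF e] assms by (simp add: A.is_up_def i_def)
  then have "B.is_up (iso v) i" using rose_cong(2)[OF assms(1) _ _ i] I by blast
  moreover have "i < degree T' (iso v)" using rose_cong(1)[OF assms(1), of "iso v"] I i by simp
  ultimately show ?thesis
    using B.nb(2)[of "iso v" i] I assms by (simp add: B.is_up_def i_def)
qed

lemma iso_inj: "inj_on iso (nodes T)"
proof (rule inj_onI)
  fix u v assume "u \<in> nodes T" "v \<in> nodes T" "iso u = iso v"
  then show "u = v"
  proof (induction "A.h v" arbitrary: u v)
    case 0
    then show ?case using A.h_0 iso_inv by metis
  next
    case (Suc k)
    have hu: "A.h u = Suc k" using Suc iso_inv by metis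
    have nr: "u \<noteq> r" "v \<noteq> r" using hu Suc.hyps(2) by auto
    note I = iso_inv[OF Suc.prems(1)] iso_inv[OF Suc.prems(2)]
    have "iso (A.par u) = iso (A.par v)" using I nr Suc.prems(3) by simp
    then have p: "A.par u = A.par v"
      using Suc.hyps(1)[of "A.par v" "A.par u"] A.par(2) A.par_in Suc.prems Suc.hyps(2) nr
      by force
    have "port T (A.par v) u = port T (A.par v) v" using I nr Suc.prems(3) p by simp
    then show ?case
      using A.port_inj A.par(1)[OF Suc.prems(1) nr(1)] A.par(1)[OF Suc.prems(2) nr(2)] p by metis
  qed
qed

lemma card_le: "card (nodes T) \<le> card (nodes T')"
  using card_inj_on_le[OF iso_inj _ B.finite_nodes] iso_inv by blast

text \<open>With the two trees exchanged, \<open>card_le\<close> gives the opposite inequality. So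
  the node sets have the same size and the injection \<open>iso\<close> is onto.\<close>

interpretation S: rooted_tree_pair T' r' T r
  by unfold_locales (rule rose_root[symmetric])

lemma tree_iso: "tree_iso iso T T'"
  unfolding tree_iso_def
proof (intro conjI ballI)
  have "card (nodes T) = card (nodes T')"
    using card_le S.card_le by simp
  then have "iso ` nodes T = nodes T'"
    using iso_inv card_image[OF iso_inj] by (intro card_subset_eq B.finite_nodes) auto
  then show "bij_betw iso (nodes T) (nodes T')"
    using iso_inj by (simp add: bij_betw_def)
next
  have down: "{iso (A.par v), iso v} \<in> edges T'" if "v \<in> nodes T" "v \<noteq> r" for v
    using iso_inv[OF that(1)] B.par(1)[of "iso v"] that by simp
  have down2: "{iso v, iso (A.par v)} \<in> edges T'" if "v \<in> nodes T" "v \<noteq> r" for v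
    using down[OF that] by (simp add: insert_commute)
  fix u v assume uv: "u \<in> nodes T" "v \<in> nodes T"
  show "{u, v} \<in> edges T \<longleftrightarrow> {iso u, iso v} \<in> edges T'"
  proof
    assume "{u, v} \<in> edges T"
    then show "{iso u, iso v} \<in> edges T'"
      using down down2 uv by (cases rule: A.edge_cases) auto
  next
    have *: "{A.par u, u} \<in> edges T \<and> v = A.par u"
      if "iso u \<noteq> r'" "iso v = B.par (iso u)" "u \<in> nodes T" "v \<in> nodes T" for u v
    proof -
      have "u \<noteq> r" using that(1) by (auto simp: iso_def)
      then have "iso v = iso (A.par u)" using iso_inv[OF that(3)] that by simp
      then have "v = A.par u"
        using iso_inj that A.par_in \<open>u \<noteq> r\<close> by (auto dest: inj_onD)
      then show ?thesis using A.par(1)[OF that(3) \<open>u \<noteq> r\<close>] by simp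
    qed
    assume "{iso u, iso v} \<in> edges T'"
    then show "{u, v} \<in> edges T"
    proof (cases rule: B.edge_cases)
      case 1
      then show ?thesis using *[of u v] uv by (simp add: insert_commute)
    next
      case 2
      then show ?thesis using *[of v u] uv by (simp add: insert_commute)
    qed
  qed
  show "{u, v} \<in> edges T \<longrightarrow> port T' (iso u) (iso v) = port T u v"
  proof
    assume "{u, v} \<in> edges T"
    then show "port T' (iso u) (iso v) = port T u v"
      by (cases rule: A.edge_cases) (use uv iso_inv iso_up_port in auto)
  qed
qed

end

text \<open>The root is arbitrary and not recorded. Isomorphic trees may thus get different codes,
  but equal codes still force isomorphism, which is all that decoding requires.\<close>

definition code :: "ptree \<Rightarrow> bool list" where
  "code T = (let r = SOME r. r \<in> nodes T in flat (rooted_tree.rose T r r))"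

lemma rooted_tree_some:
  assumes "port_numbered_tree T"
  shows "rooted_tree T (SOME r. r \<in> nodes T)"
proof
  have "nodes T \<noteq> {}" using assms by (simp add: port_numbered_tree_def is_tree_def)
  then show "(SOME r. r \<in> nodes T) \<in> nodes T" by (simp add: some_in_eq)
qed (rule assms)

lemma length_code:
  assumes "port_numbered_tree T"
  shows "length (code T) \<le> 4 * card (nodes T)"
  using rooted_tree.rose_size_root[OF rooted_tree_some[OF assms]]
  by (simp add: code_def Let_def length_flat)

lemma code_iso:
  assumes "port_numbered_tree T" "port_numbered_tree T'" "code T = code T'"
  shows "\<exists>\<phi>. tree_iso \<phi> T T'"
proof -
  have "rooted_tree_pair T (SOME r. r \<in> nodes T) T' (SOME r. r \<in> nodes T')"
    using assms(3) rooted_tree_some[OF assms(1)] rooted_tree_some[OF assms(2)]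
    by (simp add: rooted_tree_pair_def rooted_tree_pair_axioms_def code_def Let_def flat_inject)
  then show ?thesis using rooted_tree_pair.tree_iso by blast
qed

section \<open>The upper bound\<close>

locale tree_isomorphism =
  fixes \<phi> T T'
  assumes iso: "tree_iso \<phi> T T'" and tree: "is_tree T" and tree': "is_tree T'"
begin

lemma bij: "bij_betw \<phi> (nodes T) (nodes T')"
  using iso by (simp add: tree_iso_def)

lemma map_node: "v \<in> nodes T \<Longrightarrow> \<phi> v \<in> nodes T'"
  using bij by (auto simp: bij_betw_def)

lemma node_preimage: "v' \<in> nodes T' \<Longrightarrow> \<exists>v\<in>nodes T. v' = \<phi> v"
  using bij by (auto simp: bij_betw_def)

lemma eq_iff: "u \<in> nodes T \<Longrightarrow> v \<in> nodes T \<Longrightarrow> \<phi> u = \<phi> v \<longleftrightarrow> u = v"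
  using bij by (auto simp: bij_betw_def dest: inj_onD)

lemma edge_iff:
  "u \<in> nodes T \<Longrightarrow> v \<in> nodes T \<Longrightarrow> {\<phi> u, \<phi> v} \<in> edges T' \<longleftrightarrow> {u, v} \<in> edges T"
  using iso by (simp add: tree_iso_def)

lemma port_eq: "{u, v} \<in> edges T \<Longrightarrow> port T' (\<phi> u) (\<phi> v) = port T u v"
  using iso is_tree_edgeD[OF tree, of u v] by (simp add: tree_iso_def)

lemma reach_iff:
  assumes "u \<in> nodes T"
  shows "v \<in> nodes T \<Longrightarrow> reach T' (\<phi> u) k (\<phi> v) \<longleftrightarrow> reach T u k v"
proof (induction k arbitrary: v)
  case 0
  then show ?case using assms map_node eq_iff by simp
next
  case (Suc k)
  show ?case
  proof
    assume "reach T' (\<phi> u) (Suc k) (\<phi> v)"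
    then obtain w' where w': "reach T' (\<phi> u) k w'" "{w', \<phi> v} \<in> edges T'"
      by (auto simp: reach_Suc)
    obtain w where w: "w \<in> nodes T" "w' = \<phi> w"
      using node_preimage reach_nodes(2)[OF w'(1)] by blast
    then show "reach T u (Suc k) v"
      using w' Suc edge_iff[of w v] by (auto simp: reach_Suc)
  next
    assume "reach T u (Suc k) v"
    then obtain w where w: "reach T u k w" "{w, v} \<in> edges T"
      by (auto simp: reach_Suc)
    then have wn: "w \<in> nodes T" using reach_nodes(2) by blast
    have "reach T' (\<phi> u) k (\<phi> w)" using Suc.IH wn w by simp
    then show "reach T' (\<phi> u) (Suc k) (\<phi> v)"
      using w Suc.prems edge_iff[OF wn Suc.prems] map_node[OF Suc.prems]
      by (auto simp: reach_Suc)
  qed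
qed

lemma distance_eq:
  "u \<in> nodes T \<Longrightarrow> v \<in> nodes T \<Longrightarrow> distance T' (\<phi> u) (\<phi> v) = distance T u v"
  by (simp add: distance_LEAST reach_iff)

lemma degree_eq:
  assumes "u \<in> nodes T"
  shows "degree T' (\<phi> u) = degree T u"
proof -
  have "neighbours T' (\<phi> u) = \<phi> ` neighbours T u"
  proof (intro set_eqI iffI)
    fix w' assume "w' \<in> neighbours T' (\<phi> u)"
    then have e: "{\<phi> u, w'} \<in> edges T'" by (simp add: neighbours_def)
    obtain w where w: "w \<in> nodes T" "w' = \<phi> w"
      using node_preimage is_tree_edgeD(2)[OF tree' e] by blast
    then show "w' \<in> \<phi> ` neighbours T u"
      using e edge_iff[OF assms w(1)] by (auto simp: neighbours_def)
  next
    fix w' assume "w' \<in> \<phi> ` neighbours T u"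
    then obtain w where w: "{u, w} \<in> edges T" "w' = \<phi> w" by (auto simp: neighbours_def)
    then show "w' \<in> neighbours T' (\<phi> u)"
      using edge_iff[OF assms is_tree_edgeD(2)[OF tree w(1)]] by (simp add: neighbours_def)
  qed
  moreover have "inj_on \<phi> (neighbours T u)"
    by (rule inj_onI) (simp add: neighbours_def eq_iff is_tree_edgeD(2)[OF tree])
  ultimately show ?thesis by (simp add: degree_def card_image)
qed

lemma view_eq:
  assumes v: "v \<in> nodes T"
  shows "view T v s = view T' (\<phi> v) s"
  unfolding view_eq_iff[OF v map_node[OF v]] view_iso_def
proof (intro exI[of _ \<phi>] conjI ballI impI)
  let ?V = "local_view T v s" and ?W = "local_view T' (\<phi> v) s"
  have n: "nodes ?W = \<phi> ` nodes ?V"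
  proof (intro set_eqI iffI)
    fix w' assume w': "w' \<in> nodes ?W"
    then obtain w where "w \<in> nodes T" "w' = \<phi> w"
      using node_preimage by (auto simp: local_view_def Let_def)
    then show "w' \<in> \<phi> ` nodes ?V"
      using w' distance_eq[OF v] by (auto simp: local_view_def Let_def)
  qed (use map_node distance_eq[OF v] in \<open>auto simp: local_view_def Let_def\<close>)
  have "inj_on \<phi> (nodes ?V)"
    by (rule inj_onI) (auto simp: local_view_def Let_def eq_iff)
  then show "bij_betw \<phi> (nodes ?V) (nodes ?W)" by (simp add: bij_betw_def n)
  show "\<phi> (vroot ?V) = vroot ?W" by (simp add: local_view_def Let_def)
  fix u assume u: "u \<in> nodes ?V"
  then have uT: "u \<in> nodes T" by (simp add: local_view_def Let_def)
  show "bdeg ?W (\<phi> u) = bdeg ?V u"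
    using uT by (simp add: local_view_def Let_def distance_eq[OF v] degree_eq)
  fix w assume w: "w \<in> nodes ?V"
  then have wT: "w \<in> nodes T" by (simp add: local_view_def Let_def)
  show "{u, w} \<in> edges ?V \<longleftrightarrow> {\<phi> u, \<phi> w} \<in> edges ?W"
    using u w uT wT map_node
    by (simp add: local_view_def Let_def edge_iff distance_eq[OF v])
  assume "{u, w} \<in> edges ?V"
  then show "port ?W (\<phi> u) (\<phi> w) = port ?V u w"
    by (simp add: local_view_def Let_def port_eq)
qed

lemma follows_map:
  assumes "follows T v ps xs"
  shows "follows T' (\<phi> v) ps (map \<phi> xs)"
proof -
  have w: "walk T xs" "hd xs = v" "length xs = Suc (length ps)"
    and p: "\<And>i. i < length ps \<Longrightarrow> port T (xs ! i) (xs ! Suc i) = ps ! i"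
    using assms by (auto simp: follows_def)
  have n: "xs \<noteq> []" using w(3) by auto
  have e: "{xs ! i, xs ! Suc i} \<in> edges T" if "Suc i < length xs" for i
    using w(1) that by (auto simp: walk_def)
  have e': "{\<phi> (xs ! i), \<phi> (xs ! Suc i)} \<in> edges T'" if "Suc i < length xs" for i
    using edge_iff is_tree_edgeD[OF tree e[OF that]] e[OF that] by simp
  have "set (map \<phi> xs) \<subseteq> nodes T'"
    using w(1) map_node by (auto simp: walk_def)
  then have "walk T' (map \<phi> xs)"
    unfolding walk_def using e' n by simp
  moreover have "port T' (map \<phi> xs ! i) (map \<phi> xs ! Suc i) = ps ! i" if "i < length ps" for i
    using that w(3) p port_eq[OF e] by simp
  ultimately show ?thesis
    using w n by (simp add: follows_def hd_map)
qed

lemma elects_leader_map: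
  assumes "elects_leader T P" "\<And>v. v \<in> nodes T \<Longrightarrow> P' (\<phi> v) = P v"
  shows "elects_leader T' P'"
proof -
  obtain l where l: "l \<in> nodes T"
    and P: "\<And>v. v \<in> nodes T \<Longrightarrow> \<exists>xs. follows T v (P v) xs \<and> simple_path T xs \<and> last xs = l"
    using assms(1) unfolding elects_leader_def by blast
  have "\<exists>xs. follows T' v' (P' v') xs \<and> simple_path T' xs \<and> last xs = \<phi> l"
    if v': "v' \<in> nodes T'" for v'
  proof -
    obtain v where v: "v \<in> nodes T" "v' = \<phi> v" using node_preimage[OF v'] by blast
    obtain xs where xs: "follows T v (P v) xs" "simple_path T xs" "last xs = l"
      using P[OF v(1)] by blast
    have s: "set xs \<subseteq> nodes T" "xs \<noteq> []" "distinct xs"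
      using xs(2) by (auto simp: simple_path_def walk_def)
    have i: "inj_on \<phi> (set xs)"
      using bij s(1) by (auto simp: bij_betw_def intro: inj_on_subset)
    have f: "follows T' v' (P' v') (map \<phi> xs)"
      using follows_map[OF xs(1)] v assms(2) by simp
    then have "simple_path T' (map \<phi> xs)"
      using i s(3) by (simp add: follows_def simple_path_def distinct_map)
    then show ?thesis using f s(2) xs(3) by (auto simp: last_map)
  qed
  then show ?thesis using map_node[OF l] unfolding elects_leader_def by blast
qed

end

text \<open>Views of different radii can coincide only when both show the whole tree.\<close>

lemma view_eq_smaller_radius:
  assumes T: "is_tree T" and v: "v \<in> nodes T" and w: "w \<in> nodes T"
    and eq: "view T v s = view T w t" and st: "s < t"
  shows "view T v s = view T v t"
proof -
  obtain \<chi> where bij: "bij_betw \<chi> (nodes (local_view T v s)) (nodes (local_view T w t))"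
    and rt: "\<chi> v = w"
    and bd: "\<And>u. u \<in> nodes T \<Longrightarrow> distance T v u \<le> s \<Longrightarrow>
        bdeg (local_view T w t) (\<chi> u) = bdeg (local_view T v s) u"
    and ed: "\<And>u u'. u \<in> nodes T \<Longrightarrow> distance T v u \<le> s \<Longrightarrow> u' \<in> nodes T \<Longrightarrow>
        distance T v u' \<le> s \<Longrightarrow> {u, u'} \<in> edges T \<Longrightarrow> {\<chi> u, \<chi> u'} \<in> edges T"
    using eq unfolding view_eq_iff[OF v w] view_iso_def
    by (auto simp: local_view_def Let_def)
  have \<chi>: "\<chi> u \<in> nodes T \<and> distance T w (\<chi> u) \<le> t"
    if "u \<in> nodes T" "distance T v u \<le> s" for u
    using bij that by (auto simp: bij_betw_def local_view_def Let_def)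
  have r: "reach T w k (\<chi> y)" if "reach T v k y" "k \<le> s" for k y
    using that
  proof (induction k arbitrary: y)
    case 0
    then show ?case using rt w by auto
  next
    case (Suc k)
    then obtain x where x: "reach T v k x" "{x, y} \<in> edges T" by (auto simp: reach_Suc)
    note E = is_tree_edgeD[OF T x(2)]
    have dx: "distance T v x \<le> s" using distance_le[OF x(1)] Suc.prems(2) by simp
    have dy: "distance T v y \<le> s" using distance_le[OF Suc.prems(1)] Suc.prems(2) by simp
    have "{\<chi> x, \<chi> y} \<in> edges T" using ed E dx dy x(2) by blast
    moreover have "reach T w k (\<chi> x)" using Suc.IH[OF x(1)] Suc.prems(2) by simp
    ultimately show ?case using \<chi>[OF E(2) dy] by (auto simp: reach_Suc)
  qed
  \<comment> \<open>A node at distance exactly \<open>s\<close> shows its degree in the smaller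
    view, so its image must lie at distance exactly \<open>t\<close>. Yet walks map to walks, which
    puts the image within distance \<open>s < t\<close>.\<close>
  have no: "distance T v y \<noteq> s" if y: "y \<in> nodes T" for y
  proof
    assume d: "distance T v y = s"
    have "distance T w (\<chi> y) = t"
      using bd[OF y] d by (auto simp: local_view_def Let_def split: if_splits)
    moreover have "distance T w (\<chi> y) \<le> s"
      using r[of s y] is_tree_reach[OF T v y] d by (auto intro: distance_le)
    ultimately show False using st by simp
  qed
  then have lt: "distance T v y < s" if "y \<in> nodes T" for y
    using distance_ivt[OF T v that, of s] by (meson not_le)
  then have le: "distance T v y \<le> s \<and> distance T v y \<le> t \<and> distance T v y \<noteq> s \<and> distance T v y \<noteq> t"
    if "y \<in> nodes T" for y
    using that st by force
  have B: "{u \<in> nodes T. distance T v u \<le> s} = nodes T" "{u \<in> nodes T. distance T v u \<le> t} = nodes T"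
    using le by auto
  show ?thesis
    unfolding view_eq_iff[OF v v] view_iso_def
    by (rule exI[of _ id]) (use le in \<open>simp add: local_view_def Let_def B\<close>)
qed

lemma xi_leD:
  assumes "xi T \<le> enat t"
  shows "\<exists>s f. s \<le> t \<and> elects_leader T (\<lambda>v. f (view T v s))"
proof -
  \<comment> \<open>Only a strict bound on an infimum yields a member of the set below it.\<close>
  have "xi T < enat (Suc t)"
    using assms by (rule order.strict_trans1) simp
  then show ?thesis unfolding xi_def by (auto simp: Inf_less_iff less_Suc_eq_le)
qed

text \<open>All nodes receive the same advice and hence make the same choices: a tree of
  \<open>C\<close> with that code, and for it a radius and an output function. The chosen tree need
  not be the actual one, but it is isomorphic to it, so both have the same views.\<close>

lemma min_advice_le:
  assumes "\<And>T. T \<in> C \<Longrightarrow> port_numbered_tree T \<and> card (nodes T) \<le> N \<and> xi T \<le> enat t"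
  shows "min_advice C t \<le> enat (4 * N)"
proof -
  define rep where "rep a = (SOME T. T \<in> C \<and> code T = a)" for a
  define good where "good a sf \<longleftrightarrow> fst sf \<le> t \<and>
      elects_leader (rep a) (\<lambda>v. snd sf (view (rep a) v (fst sf)))"
    for a and sf :: "nat \<times> (pview set \<Rightarrow> nat list)"
  define alg where "alg V a =
      (let (s, f) = SOME sf. good a sf in
       if \<exists>w\<in>nodes (rep a). V = view (rep a) w s then Some (f V) else None)" for V a
  have "elects_within alg code C t"
    unfolding elects_within_def
  proof
    fix T assume T: "T \<in> C"
    define S where "S = rep (code T)"
    have "S \<in> C \<and> code S = code T"
      unfolding S_def rep_def by (rule someI[of _ T]) (simp add: T)
    then have S: "S \<in> C" "code S = code T" by auto
    have pT: "port_numbered_tree T" and pS: "port_numbered_tree S" using assms T S by auto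
    obtain \<phi> where \<phi>: "tree_iso \<phi> S T" using code_iso[OF pS pT S(2)] by blast
    interpret tree_isomorphism \<phi> S T
      by unfold_locales (use \<phi> pS pT in \<open>simp_all add: port_numbered_tree_def\<close>)
    obtain s0 f0 where "s0 \<le> t \<and> elects_leader S (\<lambda>v. f0 (view S v s0))"
      using xi_leD assms S(1) by blast
    then have "good (code T) (s0, f0)" by (simp add: good_def S_def)
    then have g: "good (code T) (SOME sf. good (code T) sf)" by (rule someI)
    obtain s f where sf: "(SOME sf. good (code T) sf) = (s, f)" by force
    have st: "s \<le> t" and el: "elects_leader S (\<lambda>v. f (view S v s))"
      using g[unfolded sf] by (auto simp: good_def S_def)
    have alg: "alg V (code T) = (if \<exists>w\<in>nodes T. V = view T w s then Some (f V) else None)" for V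
    proof -
      have "(\<exists>w\<in>nodes S. V = view S w s) \<longleftrightarrow> (\<exists>w\<in>nodes T. V = view T w s)"
        using node_preimage map_node view_eq by metis
      then show ?thesis by (simp add: alg_def sf S_def)
    qed
    define hlt where "hlt v = (LEAST r. alg (view T v r) (code T) \<noteq> None)" for v
    have ns: "alg (view T v s) (code T) \<noteq> None" if "v \<in> nodes T" for v
      using that by (auto simp: alg)
    have hs: "hlt v \<le> s" if "v \<in> nodes T" for v
      unfolding hlt_def by (rule Least_le) (rule ns[OF that])
    have hn: "alg (view T v (hlt v)) (code T) \<noteq> None" if "v \<in> nodes T" for v
      unfolding hlt_def by (rule LeastI[of _ s]) (rule ns[OF that])
    \<comment> \<open>A node may halt before round \<open>s\<close>, at a view that equals the
      radius-\<open>s\<close> view of some node. Its view then no longer changes up to round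
      \<open>s\<close>, so \<open>f\<close> is applied to the intended argument.\<close>
    have out: "the (alg (view T v (hlt v)) (code T)) = f (view T v s)" if v: "v \<in> nodes T" for v
    proof -
      obtain w where w: "w \<in> nodes T" "view T v (hlt v) = view T w s"
        using hn[OF v] by (auto simp: alg split: if_splits)
      have "view T v (hlt v) = view T v s"
        using view_eq_smaller_radius[OF tree' v w] hs[OF v] by (cases "hlt v = s") auto
      then show ?thesis using v by (auto simp: alg)
    qed
    have "halts_at alg (code T) T v (hlt v) \<and> hlt v \<le> t" if v: "v \<in> nodes T" for v
    proof -
      have "alg (view T v r) (code T) = None" if "r < hlt v" for r
        using not_less_Least[OF that[unfolded hlt_def]] by simp
      then show ?thesis
        using hn[OF v] hs[OF v] st by (simp add: halts_at_def)
    qed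
    moreover have "elects_leader T (\<lambda>v. the (alg (view T v (hlt v)) (code T)))"
      using el by (rule elects_leader_map) (simp add: out map_node view_eq)
    ultimately show "\<exists>h. (\<forall>v\<in>nodes T. halts_at alg (code T) T v (h v) \<and> h v \<le> t) \<and>
               elects_leader T (\<lambda>v. the (alg (view T v (h v)) (code T)))"
      by blast
  qed
  then have "min_advice C t \<le> (SUP T\<in>C. enat (length (code T)))"
    unfolding min_advice_def by (intro Inf_lower) blast
  also have "\<dots> \<le> enat (4 * N)"
  proof (rule SUP_least)
    fix T assume "T \<in> C"
    then have "port_numbered_tree T" "card (nodes T) \<le> N" using assms by auto
    then show "enat (length (code T)) \<le> enat (4 * N)"
      using length_code[of T] by simp
  qed
  finally show ?thesis .
qed

section \<open>The lower-bound trees\<close>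

text \<open>\<open>up u\<close> is the port at \<open>u\<close> towards its parent,
  \<open>dn v\<close> the port at the parent of \<open>v\<close> towards \<open>v\<close>. The shape
  depends on \<open>p\<close> only, so trees that differ just in their ports share all metric
  facts.\<close>

definition parent_tree ::
    "nat set \<Rightarrow> nat \<Rightarrow> (nat \<Rightarrow> nat) \<Rightarrow> (nat \<Rightarrow> nat) \<Rightarrow> (nat \<Rightarrow> nat) \<Rightarrow> ptree" where
  "parent_tree V r p up dn =
     \<lparr>nodes = V, edges = (\<lambda>v. {v, p v}) ` (V - {r}),
      port = (\<lambda>u v. if v \<in> V - {r} \<and> p v = u then dn v else up u)\<rparr>"

section \<open>Trees given by a parent map\<close>

locale parent_map =
  fixes V :: "nat set" and r :: nat and p :: "nat \<Rightarrow> nat" and depth :: "nat \<Rightarrow> nat"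
  assumes fin: "finite V" and root: "r \<in> V" and depth_root: "depth r = 0"
    and p_in: "\<And>v. v \<in> V \<Longrightarrow> v \<noteq> r \<Longrightarrow> p v \<in> V"
    and depth_p: "\<And>v. v \<in> V \<Longrightarrow> v \<noteq> r \<Longrightarrow> depth v = Suc (depth (p v))"
begin

lemma nodes_parent_tree [simp]: "nodes (parent_tree V r p up dn) = V"
  by (simp add: parent_tree_def)

lemma edge_iff:
  "{u, v} \<in> edges (parent_tree V r p up dn) \<longleftrightarrow>
     u \<in> V \<and> u \<noteq> r \<and> v = p u \<or> v \<in> V \<and> v \<noteq> r \<and> u = p v"
  by (auto simp: parent_tree_def doubleton_eq_iff)

lemma port_up:
  assumes "u \<in> V" "u \<noteq> r"
  shows "port (parent_tree V r p up dn) u (p u) = up u"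
proof -
  have "\<not> (p u \<in> V - {r} \<and> p (p u) = u)"
    using depth_p[OF assms] depth_p[of "p u"] by auto
  then show ?thesis by (auto simp: parent_tree_def)
qed

lemma port_dn:
  "v \<in> V \<Longrightarrow> v \<noteq> r \<Longrightarrow> port (parent_tree V r p up dn) (p v) v = dn v"
  by (simp add: parent_tree_def)

lemma reach_root: "v \<in> V \<Longrightarrow> reach (parent_tree V r p up dn) r (depth v) v"
proof (induction "depth v" arbitrary: v)
  case 0
  then have "v = r" using depth_p[of v] by auto
  then show ?case using depth_root root by simp
next
  case (Suc k)
  then have nr: "v \<noteq> r" using depth_root by auto
  have d: "depth (p v) = k" using depth_p[OF Suc.prems nr] Suc.hyps(2) by simp
  have "reach (parent_tree V r p up dn) r k (p v)"
    using Suc.hyps(1)[of "p v"] d p_in[OF Suc.prems nr] by simp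
  then show ?case
    unfolding Suc.hyps(2)[symmetric] using Suc.prems nr by (auto simp: reach_Suc edge_iff)
qed

text \<open>In a cycle, both neighbours of a deepest node would be its parent.\<close>

lemma is_tree_parent_tree: "is_tree (parent_tree V r p up dn)"
proof -
  let ?T = "parent_tree V r p up dn"
  have "e \<subseteq> nodes ?T \<and> card e = 2" if e: "e \<in> edges ?T" for e
  proof -
    obtain v where v: "v \<in> V" "v \<noteq> r" "e = {v, p v}"
      using e by (auto simp: parent_tree_def)
    have "v \<noteq> p v" using depth_p[OF v(1,2)] by auto
    then show ?thesis using v p_in by simp
  qed
  moreover have "\<exists>xs. walk ?T xs \<and> hd xs = u \<and> last xs = v" if "u \<in> V" "v \<in> V" for u v
    using reach_trans[OF reach_sym[OF reach_root[OF that(1)]] reach_root[OF that(2)]]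
    unfolding reach_def by blast
  moreover have "\<not> cycle ?T xs" for xs
  proof
    assume c: "cycle ?T xs"
    then have dist: "distinct xs" and n3: "3 \<le> length xs" and le: "{last xs, hd xs} \<in> edges ?T"
      and se: "\<And>i. Suc i < length xs \<Longrightarrow> {xs ! i, xs ! Suc i} \<in> edges ?T"
      by (auto simp: cycle_def simple_path_def walk_def)
    have ne: "xs \<noteq> []" using n3 by auto
    define m where "m = Max (depth ` set xs)"
    have "m \<in> depth ` set xs" unfolding m_def using ne by (intro Max_in) auto
    then obtain i where i: "i < length xs" "depth (xs ! i) = m"
      by (auto simp: in_set_conv_nth)
    have mx: "depth (xs ! k) \<le> depth (xs ! i)" if "k < length xs" for k
      unfolding i(2) m_def using that by (intro Max_ge) auto
    \<comment> \<open>\<open>a\<close> and \<open>b\<close> are the cyclic successor and predecessor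
      of \<open>i\<close>; they differ because the cycle has at least 3 nodes.\<close>
    define a where "a = (if Suc i < length xs then Suc i else 0)"
    define b where "b = (if i = 0 then length xs - 1 else i - 1)"
    have ab: "a < length xs" "b < length xs" "a \<noteq> b"
      using i n3 by (auto simp: a_def b_def split: if_splits)
    have ends: "last xs = xs ! (length xs - 1)" "hd xs = xs ! 0"
      using ne by (simp_all add: last_conv_nth hd_conv_nth)
    have ea: "{xs ! i, xs ! a} \<in> edges ?T"
    proof (cases "Suc i < length xs")
      case False
      then have "i = length xs - 1" using i by auto
      then show ?thesis using le ends False by (simp add: a_def)
    qed (use se in \<open>simp add: a_def\<close>)
    have eb: "{xs ! i, xs ! b} \<in> edges ?T"
    proof (cases i)
      case 0
      then show ?thesis using le ends by (simp add: b_def insert_commute)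
    next
      case (Suc k)
      then show ?thesis using se[of k] i by (simp add: b_def insert_commute)
    qed
    have par: "xs ! k = p (xs ! i)" if "{xs ! i, xs ! k} \<in> edges ?T" "k < length xs" for k
      using that(1) mx[OF that(2)] depth_p[of "xs ! k"] unfolding edge_iff by auto
    have "xs ! a = xs ! b" using par[OF ea ab(1)] par[OF eb ab(2)] by simp
    then show False using dist ab by (simp add: nth_eq_iff_index_eq)
  qed
  ultimately show ?thesis using fin root unfolding is_tree_def by auto
qed

lemma depth_funpow: "v \<in> V \<Longrightarrow> k \<le> depth v \<Longrightarrow>
    (p ^^ k) v \<in> V \<and> depth ((p ^^ k) v) = depth v - k"
proof (induction k)
  case (Suc k)
  then have I: "(p ^^ k) v \<in> V" "depth ((p ^^ k) v) = depth v - k" by auto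
  then have "(p ^^ k) v \<noteq> r" using Suc.prems depth_root by auto
  then show ?case using p_in[OF I(1)] depth_p[OF I(1)] I(2) by simp
qed simp

lemma elects_leader_root:
  "elects_leader (parent_tree V r p up dn) (\<lambda>v. map (\<lambda>k. up ((p ^^ k) v)) [0..<depth v])"
  unfolding elects_leader_def
proof (intro bexI[of _ r] ballI)
  let ?T = "parent_tree V r p up dn"
  fix v assume "v \<in> nodes ?T"
  then have v: "v \<in> V" by simp
  let ?xs = "map (\<lambda>k. (p ^^ k) v) [0..<Suc (depth v)]"
  note dp = depth_funpow[OF v]
  have nr: "(p ^^ k) v \<noteq> r" if "k < depth v" for k
    using dp[of k] that depth_root by auto
  have nth: "?xs ! k = (p ^^ k) v" if "k \<le> depth v" for k
    using that by (simp del: upt_Suc)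
  have "{?xs ! i, ?xs ! Suc i} \<in> edges ?T" if "Suc i < length ?xs" for i
    using that nth[of i] nth[of "Suc i"] nr[of i] dp[of i] by (simp add: edge_iff del: upt_Suc)
  then have w: "walk ?T ?xs" using dp unfolding walk_def by (auto simp del: upt_Suc)
  have "distinct ?xs"
  proof (subst distinct_map, intro conjI inj_onI)
    fix i k assume "i \<in> set [0..<Suc (depth v)]" "k \<in> set [0..<Suc (depth v)]"
      "(p ^^ i) v = (p ^^ k) v"
    then have "i \<le> depth v" "k \<le> depth v" "depth v - i = depth v - k"
      using dp[of i] dp[of k] by auto
    then show "i = k" by simp
  qed simp
  moreover have "last ?xs = r"
  proof -
    have "(p ^^ depth v) v = r"
      using dp[of "depth v"] depth_p[of "(p ^^ depth v) v"] by auto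
    then show ?thesis by simp
  qed
  moreover have "hd ?xs = v" by (simp add: hd_map del: upt_Suc)
  moreover have "port ?T (?xs ! i) (?xs ! Suc i) = up ((p ^^ i) v)" if "i < depth v" for i
    using nth[of i] nth[of "Suc i"] that port_up[of "(p ^^ i) v"] dp[of i] nr[of i]
    by (simp del: upt_Suc)
  ultimately show "\<exists>xs. follows ?T v (map (\<lambda>k. up ((p ^^ k) v)) [0..<depth v]) xs \<and>
      simple_path ?T xs \<and> last xs = r"
    using w by (intro exI[of _ ?xs]) (simp add: follows_def simple_path_def del: upt_Suc)
qed (simp add: root)

end

text \<open>There are \<open>3 * K\<close> arms with \<open>M\<close> free bits each. Identifiers have \<open>l\<close> bits, which is also
  the spacing of the hanging paths; \<open>t\<close> is the radius of the views.\<close>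

locale spider =
  fixes D K L l M t :: nat
  assumes L_def: "L = D div 2" and K: "1 \<le> K"
    and id_bound: "\<And>j i. j < 3 * K \<Longrightarrow> i \<le> L \<Longrightarrow> 4 * (j * (L + 2) + i) + 2 < 2 ^ l"
    and room: "M + 2 + t \<le> L" and radius: "4 * l + 4 \<le> t"
begin

text \<open>Arm 0 is one longer when \<open>D\<close> is odd, so that it makes up the exact diameter
  \<open>D\<close> together with any other arm.\<close>

definition len :: "nat \<Rightarrow> nat" where
  "len j = (if j = 0 then D - L else L)"

text \<open>The condition \<open>i + l \<le> L\<close> keeps the tips of the hanging paths within
  depth \<open>L\<close>, so they do not increase the diameter.\<close>

definition mark :: "nat \<Rightarrow> bool" where
  "mark i \<longleftrightarrow> 0 < i \<and> l dvd i \<and> i + l \<le> L"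

text \<open>\<open>E j i 0\<close> is the node at distance \<open>i\<close> from the centre on arm \<open>j\<close>, and \<open>E j i s\<close> the
  \<open>s\<close>-th node of the path hanging from it. All \<open>E j 0 s\<close> are the centre.\<close>

definition E :: "nat \<Rightarrow> nat \<Rightarrow> nat \<Rightarrow> nat" where
  "E j i s = to_nat (if i = 0 then (0, 0, 0) else (j, i, s))"

abbreviation R :: nat where
  "R \<equiv> E 0 0 0"

definition valid :: "nat \<Rightarrow> nat \<Rightarrow> nat \<Rightarrow> bool" where
  "valid j i s \<longleftrightarrow> j < 3 * K \<and> (s = 0 \<and> i \<le> len j \<or> mark i \<and> s \<le> l)"

definition V :: "nat set" where
  "V = {E j i s | j i s. valid j i s}"

definition p :: "nat \<Rightarrow> nat" where
  "p x = (case from_nat x of (j, i, s) \<Rightarrow> if 0 < s then E j i (s - 1) else E j (i - 1) 0)"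

definition depth :: "nat \<Rightarrow> nat" where
  "depth x = (case from_nat x of (j :: nat, i, s :: nat) \<Rightarrow> i + s)"

definition arm :: "nat \<Rightarrow> nat" where
  "arm x = (case from_nat x of (j, i :: nat, s :: nat) \<Rightarrow> j)"

definition pos :: "nat \<Rightarrow> nat" where
  "pos x = (case from_nat x of (j :: nat, i, s :: nat) \<Rightarrow> i)"

text \<open>Node \<open>s\<close> of a hanging path spells bit \<open>s\<close>. Since
  \<open>s = 0\<close> is a node of the arm, bit 0 must carry no information, and bit 1 is the
  marker; this leaves the multiples of 4 for the pair, which is numbered injectively as
  \<open>i < L + 2\<close>.\<close>

definition ident :: "nat \<Rightarrow> nat \<Rightarrow> nat" where
  "ident j i = 4 * (j * (L + 2) + i) + 2"

text \<open>The port towards the centre: on the arms it spells the free bits \<open>b\<close> (arms congruent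
  modulo \<open>K\<close> sharing their bits), on a hanging path the identifier of its starting node. Bit 1 of
  an identifier is set, which tells hanging paths from arms at the centre.\<close>

definition U :: "(nat \<times> nat) set \<Rightarrow> nat \<Rightarrow> nat \<Rightarrow> nat \<Rightarrow> nat" where
  "U b j i s = of_bool (if s = 0 then (j mod K, i) \<in> b else bit (ident j i) s)"

definition up :: "(nat \<times> nat) set \<Rightarrow> nat \<Rightarrow> nat" where
  "up b x = (case from_nat x of (j, i, s) \<Rightarrow> U b j i s)"

text \<open>At inner nodes the two ports along an arm, or along a hanging path, are complementary
  bits, so one bit per node can be prescribed. Port 2 opens a hanging path, and the centre numbers
  its arms.\<close>

definition dn :: "(nat \<times> nat) set \<Rightarrow> nat \<Rightarrow> nat" where
  "dn b x = (case from_nat x of (j, i, s) \<Rightarrow>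
     if s = 1 then 2 else if s = 0 \<and> i = 1 then j
     else 1 - (if s = 0 then U b j (i - 1) 0 else U b j i (s - 1)))"

definition T :: "(nat \<times> nat) set \<Rightarrow> ptree" where
  "T b = parent_tree V R p (up b) (dn b)"

text \<open>Position 1 keeps the bit 0, so that an arm never starts like a hanging path. The upper
  end is due to \<open>room\<close>: an end node sees positions from \<open>M + 2\<close>
  on.\<close>

definition free :: "(nat \<times> nat) set" where
  "free = {..<K} \<times> {2..<M + 2}"

lemma L_len: "L \<le> len j" "len j \<le> Suc L"
proof -
  have "D - L \<le> Suc L" "L \<le> D - L" using L_def by linarith+
  then show "L \<le> len j" "len j \<le> Suc L" by (auto simp: len_def)
qed

lemma l2: "2 \<le> l"
proof (rule ccontr)
  assume "\<not> 2 \<le> l"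
  then have "(2::nat) ^ l \<le> 2 ^ 1" by (intro power_increasing) auto
  then show False using id_bound[of 0 0] K by simp
qed

lemma from_E: "from_nat (E j i s) = (if i = 0 then (0, 0, 0) else (j, i, s))"
  by (simp add: E_def)

lemma E_0: "E j 0 s = R"
  by (simp add: E_def)

lemma E_eq: "E j i s = E j' i' s' \<longleftrightarrow> i = 0 \<and> i' = 0 \<or> i \<noteq> 0 \<and> j = j' \<and> i = i' \<and> s = s'"
  by (auto simp: E_def)

lemma E_R: "E j i s = R \<longleftrightarrow> i = 0"
  by (auto simp: E_eq)

lemma p_arm: "p (E j (Suc i) 0) = E j i 0"
  by (simp add: p_def from_E)

lemma p_hang: "0 < i \<Longrightarrow> p (E j i (Suc s)) = E j i s"
  by (simp add: p_def from_E)

lemma mark_pos: "mark i \<Longrightarrow> 0 < i"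
  by (simp add: mark_def)

lemma V_arm: "j < 3 * K \<Longrightarrow> i \<le> len j \<Longrightarrow> E j i 0 \<in> V"
  by (auto simp: V_def valid_def)

lemma V_hang: "j < 3 * K \<Longrightarrow> mark i \<Longrightarrow> s \<le> l \<Longrightarrow> E j i s \<in> V"
  by (auto simp: V_def valid_def)

lemma R_V: "R \<in> V"
  using V_arm[of 0 0] K by simp

lemma mark_less: "mark i \<Longrightarrow> i < len j"
  using L_len(1)[of j] l2 by (simp add: mark_def)

lemma V_cases:
  assumes "x \<in> V" "x \<noteq> R"
  obtains (arm) j i where "x = E j (Suc i) 0" "j < 3 * K" "Suc i \<le> len j" "p x = E j i 0"
  | (hang) j i s where "x = E j i (Suc s)" "j < 3 * K" "mark i" "s < l" "p x = E j i s"
proof -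
  obtain j i s where x: "x = E j i s" "valid j i s" using assms(1) by (auto simp: V_def)
  have i: "0 < i" using assms(2) x(1) by (simp add: E_R)
  show ?thesis
  proof (cases s)
    case 0
    obtain k where k: "i = Suc k" using i by (cases i) auto
    have "Suc k \<le> len j" using x(2) 0 mark_less[of i j] by (auto simp: valid_def k)
    then show ?thesis using arm[of j k] x 0 k by (simp add: p_arm valid_def)
  next
    case (Suc s')
    then show ?thesis using hang[of j i s'] x i by (auto simp: p_hang valid_def)
  qed
qed

lemma finite_V: "finite V"
proof -
  have "V \<subseteq> (\<lambda>(j, i, s). E j i s) ` ({..<3 * K} \<times> {..Suc L} \<times> {..l})"
  proof
    fix x assume "x \<in> V"
    then obtain j i s where x: "x = E j i s" "valid j i s" by (auto simp: V_def)
    then have "(j, i, s) \<in> {..<3 * K} \<times> {..Suc L} \<times> {..l}"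
      using L_len(2)[of j] by (auto simp: valid_def mark_def)
    then show "x \<in> (\<lambda>(j, i, s). E j i s) ` ({..<3 * K} \<times> {..Suc L} \<times> {..l})"
      using x(1) by force
  qed
  then show ?thesis by (rule finite_subset) auto
qed

sublocale parent_map V R p depth
proof
  show "finite V" by (rule finite_V)
  show "R \<in> V" by (rule R_V)
  show "depth R = 0" by (simp add: depth_def from_E)
  fix v assume v: "v \<in> V" "v \<noteq> R"
  show "p v \<in> V"
    by (rule V_cases[OF v]) (simp_all add: V_arm V_hang)
  show "depth v = Suc (depth (p v))"
    by (rule V_cases[OF v]) (auto simp: depth_def from_E mark_def)
qed

lemma nodes_T [simp]: "nodes (T b) = V"
  by (simp add: T_def)

lemma tree_T: "is_tree (T b)"
  unfolding T_def by (rule is_tree_parent_tree)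

lemma edge_T: "{u, v} \<in> edges (T b) \<longleftrightarrow>
    u \<in> V \<and> u \<noteq> R \<and> v = p u \<or> v \<in> V \<and> v \<noteq> R \<and> u = p v"
  unfolding T_def by (rule edge_iff)

lemma edge_arm:
  assumes "j < 3 * K" "Suc i \<le> len j"
  shows "{E j i 0, E j (Suc i) 0} \<in> edges (T b)"
  using V_arm[OF assms] by (simp add: edge_T p_arm E_R)

lemma edge_hang:
  assumes "j < 3 * K" "mark i" "s < l"
  shows "{E j i s, E j i (Suc s)} \<in> edges (T b)"
  using V_hang[OF assms(1,2), of "Suc s"] assms(3) mark_pos[OF assms(2)]
  by (simp add: edge_T p_hang E_R)

lemma port_T_up: "u \<in> V \<Longrightarrow> u \<noteq> R \<Longrightarrow> port (T b) u (p u) = up b u"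
  unfolding T_def by (rule port_up)

lemma port_T_dn: "v \<in> V \<Longrightarrow> v \<noteq> R \<Longrightarrow> port (T b) (p v) v = dn b v"
  unfolding T_def by (rule port_dn)

lemma U_le: "U b j i s \<le> 1"
  by (simp add: U_def)

lemma up_le: "up b x \<le> 1"
  using U_le by (simp add: up_def split: prod.splits)

lemma U_far:
  assumes "b \<subseteq> free" "M + 2 \<le> i"
  shows "U b j i 0 = 0"
  using assms by (auto simp: U_def free_def)

text \<open>The tip of a hanging path has degree 1 and needs port 0, so identifiers must have bit
  \<open>l\<close> clear.\<close>

lemma U_last:
  assumes "j < 3 * K" "mark i"
  shows "U b j i l = 0"
proof -
  have "ident j i < 2 ^ l" using id_bound[OF assms(1), of i] assms(2)
    by (simp add: ident_def mark_def)
  then have "\<not> bit (ident j i) l" by (simp add: bit_iff_odd)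
  then show ?thesis using l2 by (simp add: U_def)
qed

section \<open>Neighbours and ports\<close>

lemma neighbours_root: "neighbours (T b) R = (\<lambda>j. E j 1 0) ` {..<3 * K}"
proof (intro set_eqI iffI)
  fix v assume "v \<in> neighbours (T b) R"
  then have v: "v \<in> V" "v \<noteq> R" "p v = R" by (auto simp: neighbours_def edge_T)
  show "v \<in> (\<lambda>j. E j 1 0) ` {..<3 * K}"
    using v(3) by (cases rule: V_cases[OF v(1,2)]) (auto simp: E_eq mark_def)
next
  fix v assume "v \<in> (\<lambda>j. E j 1 0) ` {..<3 * K}"
  then obtain j where j: "j < 3 * K" "v = E j 1 0" by auto
  have "Suc 0 \<le> len j" using room L_len(1)[of j] by simp
  from edge_arm[OF j(1) this, of b] show "v \<in> neighbours (T b) R"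
    by (simp add: neighbours_def j E_0[of j 0])
qed

lemma neighbours_arm:
  assumes "j < 3 * K" "Suc i \<le> len j"
  shows "neighbours (T b) (E j (Suc i) 0) =
    {E j i 0} \<union> (if Suc i < len j then {E j (Suc (Suc i)) 0} else {}) \<union>
    (if mark (Suc i) then {E j (Suc i) 1} else {})" (is "?N = ?S")
proof (intro set_eqI iffI)
  fix v assume "v \<in> ?N"
  then have "v = E j i 0 \<or> v \<in> V \<and> v \<noteq> R \<and> p v = E j (Suc i) 0"
    by (auto simp: neighbours_def edge_T p_arm)
  then show "v \<in> ?S"
  proof (elim disjE conjE)
    assume v: "v \<in> V" "v \<noteq> R" "p v = E j (Suc i) 0"
    show "v \<in> ?S"
      using v(3) by (cases rule: V_cases[OF v(1,2)]) (auto simp: E_eq)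
  qed simp
next
  fix v assume "v \<in> ?S"
  then consider "v = E j i 0" | "Suc i < len j" "v = E j (Suc (Suc i)) 0"
    | "mark (Suc i)" "v = E j (Suc i) 1"
    by (auto split: if_splits)
  then show "v \<in> ?N"
  proof cases
    case 1
    then show ?thesis using edge_arm[OF assms, of b] by (simp add: neighbours_def insert_commute)
  next
    case 2
    then show ?thesis using edge_arm[OF assms(1), of "Suc i" b] by (simp add: neighbours_def)
  next
    case 3
    then show ?thesis using edge_hang[OF assms(1) 3(1), of 0 b] l2 by (simp add: neighbours_def)
  qed
qed

lemma neighbours_hang:
  assumes "j < 3 * K" "mark i" "s < l"
  shows "neighbours (T b) (E j i (Suc s)) =
    {E j i s} \<union> (if Suc s < l then {E j i (Suc (Suc s))} else {})" (is "?N = ?S")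
proof (intro set_eqI iffI)
  note i = mark_pos[OF assms(2)]
  fix v assume "v \<in> ?N"
  then have "v = E j i s \<or> v \<in> V \<and> v \<noteq> R \<and> p v = E j i (Suc s)"
    using i by (auto simp: neighbours_def edge_T p_hang)
  then show "v \<in> ?S"
  proof (elim disjE conjE)
    assume v: "v \<in> V" "v \<noteq> R" "p v = E j i (Suc s)"
    show "v \<in> ?S"
      using v(3) i by (cases rule: V_cases[OF v(1,2)]) (auto simp: E_eq)
  qed simp
next
  fix v assume "v \<in> ?S"
  then consider "v = E j i s" | "Suc s < l" "v = E j i (Suc (Suc s))"
    by (auto split: if_splits)
  then show "v \<in> ?N"
  proof cases
    case 1
    then show ?thesis using edge_hang[OF assms, of b] by (simp add: neighbours_def insert_commute)
  next
    case 2
    then show ?thesis using edge_hang[OF assms(1,2) 2(1), of b] by (simp add: neighbours_def)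
  qed
qed

lemma ports_arm:
  assumes "j < 3 * K" "Suc i \<le> len j"
  shows "port (T b) (E j (Suc i) 0) (E j i 0) = U b j (Suc i) 0"
  using port_T_up[of "E j (Suc i) 0" b] V_arm[OF assms] by (simp add: p_arm E_R up_def from_E)

lemma ports_arm_down:
  assumes "j < 3 * K" "Suc i \<le> len j"
  shows "port (T b) (E j i 0) (E j (Suc i) 0) = (if i = 0 then j else 1 - U b j i 0)"
  using port_T_dn[of "E j (Suc i) 0" b] V_arm[OF assms] by (simp add: p_arm E_R dn_def from_E)

lemma ports_hang:
  assumes "j < 3 * K" "mark i" "s < l"
  shows "port (T b) (E j i (Suc s)) (E j i s) = U b j i (Suc s)"
  using port_T_up[of "E j i (Suc s)" b] V_hang[OF assms(1,2), of "Suc s"] assms(3)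
    mark_pos[OF assms(2)]
  by (simp add: p_hang E_R up_def from_E)

lemma ports_hang_down:
  assumes "j < 3 * K" "mark i" "s < l"
  shows "port (T b) (E j i s) (E j i (Suc s)) = (if s = 0 then 2 else 1 - U b j i s)"
  using port_T_dn[of "E j i (Suc s)" b] V_hang[OF assms(1,2), of "Suc s"] assms(3)
    mark_pos[OF assms(2)]
  by (simp add: p_hang E_R dn_def from_E)

lemma port_numbered_T:
  assumes "b \<subseteq> free"
  shows "port_numbered_tree (T b)"
proof -
  have "inj_on (port (T b) u) (neighbours (T b) u) \<and>
      port (T b) u ` neighbours (T b) u \<subseteq> {0..<degree (T b) u}" (is "?P u") if u: "u \<in> V" for u
  proof (cases "u = R")
    case True
    have port: "port (T b) R (E j 1 0) = j" if "j < 3 * K" for j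
      using ports_arm_down[OF that, of 0 b] L_len(1)[of j] room by (simp add: E_0[of j 0])
    have "inj_on (\<lambda>j. E j 1 0) {..<3 * K}" by (rule inj_onI) (simp add: E_eq)
    then have "degree (T b) R = 3 * K"
      unfolding degree_def neighbours_root by (simp add: card_image)
    then show ?thesis unfolding True neighbours_root using port by (auto intro!: inj_onI)
  next
    case False
    from u False show ?thesis
    proof (cases rule: V_cases)
      case (arm j i)
      note N = neighbours_arm[OF arm(2,3), of b] and pu = ports_arm[OF arm(2,3), of b]
      define a where "a = U b j (Suc i) 0"
      have "a \<le> 1" unfolding a_def by (rule U_le)
      then have a: "a \<le> 1" "a \<noteq> 1 - a" "1 - a \<noteq> a" by presburger+
      have pa: "port (T b) u (E j i 0) = a" using pu arm(1) by (simp add: a_def)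
      show ?thesis
      proof (cases "Suc i < len j")
        case False
        then have "\<not> mark (Suc i)" using mark_less by blast
        then have N': "neighbours (T b) u = {E j i 0}" using N False arm(1) by simp
        \<comment> \<open>The end of an arm has degree 1, so its port must be 0; it lies beyond the
          free positions.\<close>
        have "M + 2 \<le> Suc i" using False L_len(1)[of j] room by simp
        from U_far[OF assms this] have "port (T b) u (E j i 0) = 0" using pu arm(1) by simp
        then show ?thesis by (simp add: N' degree_def)
      next
        case True
        have pd: "port (T b) u (E j (Suc (Suc i)) 0) = 1 - a"
          using ports_arm_down[OF arm(2), of "Suc i" b] True arm(1) by (simp add: a_def)
        show ?thesis
        proof (cases "mark (Suc i)")
          case False
          then have N': "neighbours (T b) u = {E j i 0, E j (Suc (Suc i)) 0}"
            using N True arm(1) by auto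
          have "degree (T b) u = 2" by (simp add: N' degree_def E_eq)
          then show ?thesis using pd pa a by (auto simp: N')
        next
          case mk: True
          then have N': "neighbours (T b) u = {E j i 0, E j (Suc (Suc i)) 0, E j (Suc i) 1}"
            using N True arm(1) by auto
          have "port (T b) u (E j (Suc i) 1) = 2"
            using ports_hang_down[OF arm(2) mk, of 0 b] l2 arm(1) by simp
          moreover have "degree (T b) u = 3" by (simp add: N' degree_def E_eq)
          ultimately show ?thesis using pd pa a by (auto simp: N')
        qed
      qed
    next
      case (hang j i s)
      note N = neighbours_hang[OF hang(2-4), of b] and pu = ports_hang[OF hang(2-4), of b]
      define a where "a = U b j i (Suc s)"
      have "a \<le> 1" unfolding a_def by (rule U_le)
      then have a: "a \<le> 1" "a \<noteq> 1 - a" "1 - a \<noteq> a" by presburger+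
      have pa: "port (T b) u (E j i s) = a" using pu hang(1) by (simp add: a_def)
      show ?thesis
      proof (cases "Suc s < l")
        case False
        then have s: "Suc s = l" using hang(4) by simp
        have N': "neighbours (T b) u = {E j i s}" using N False hang(1) by simp
        have "port (T b) u (E j i s) = 0"
          using pu U_last[OF hang(2,3), of b] hang(1) s by simp
        then show ?thesis by (simp add: N' degree_def)
      next
        case True
        have pd: "port (T b) u (E j i (Suc (Suc s))) = 1 - a"
          using ports_hang_down[OF hang(2,3) True, of b] hang(1) by (simp add: a_def)
        have N': "neighbours (T b) u = {E j i s, E j i (Suc (Suc s))}"
          using N True hang(1) by auto
        have "degree (T b) u = 2"
          using mark_pos[OF hang(3)] by (simp add: N' degree_def E_eq)
        then show ?thesis using pd pa a by (auto simp: N')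
      qed
    qed
  qed
  then show ?thesis using tree_T by (simp add: port_numbered_tree_def)
qed

subsection \<open>Diameter, size and views\<close>

lemma arm_E: "arm (E j i s) = (if i = 0 then 0 else j)"
  by (simp add: arm_def from_E)

lemma pos_E: "pos (E j i s) = i"
  by (simp add: pos_def from_E)

lemma depth_E: "depth (E j i s) = (if i = 0 then 0 else i + s)"
  by (simp add: depth_def from_E)

lemma reach_arm:
  assumes "j < 3 * K" "i + k \<le> len j"
  shows "reach (T b) (E j i 0) k (E j (i + k) 0)"
  using assms(2)
proof (induction k)
  case 0
  then show ?case using V_arm[OF assms(1), of i] by simp
next
  case (Suc k)
  then show ?case
    using edge_arm[OF assms(1), of "i + k" b] V_arm[OF assms(1), of "i + Suc k"]
    by (auto simp: reach_Suc)
qed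

lemma reach_hang:
  assumes "j < 3 * K" "mark i" "s \<le> l"
  shows "reach (T b) (E j i 0) s (E j i s)"
  using assms(3)
proof (induction s)
  case 0
  then show ?case using V_hang[OF assms(1,2), of 0] by simp
next
  case (Suc s)
  then show ?case
    using edge_hang[OF assms(1,2), of s b] V_hang[OF assms(1,2), of "Suc s"]
    by (auto simp: reach_Suc)
qed

lemma distance_arm:
  assumes "j < 3 * K" "i \<le> len j" "i' \<le> len j" "i' \<le> i + k" "i \<le> i' + k"
  shows "distance (T b) (E j i 0) (E j i' 0) \<le> k"
proof (cases "i \<le> i'")
  case True
  then show ?thesis
    using distance_le[OF reach_arm[OF assms(1), of i "i' - i" b]] assms by simp
next
  case False
  then show ?thesis
    using distance_le[OF reach_sym[OF reach_arm[OF assms(1), of i' "i - i'" b]]] assms by simp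
qed

lemma D_cases: "D = 2 * L \<or> D = 2 * L + 1"
  using L_def by linarith

lemma depth_cases:
  assumes "x \<in> V"
  shows "depth x \<le> L \<or> x = E 0 (Suc L) 0 \<and> depth x = Suc L \<and> D = 2 * L + 1"
proof (cases "x = R")
  case True
  then show ?thesis by (simp add: depth_E)
next
  case False
  from assms False show ?thesis
  proof (cases rule: V_cases)
    case (arm j i)
    then have "Suc i \<le> L \<or> j = 0 \<and> i = L \<and> D = 2 * L + 1"
      using D_cases by (auto simp: len_def split: if_splits)
    then show ?thesis using arm(1) by (auto simp: depth_E)
  next
    case (hang j i s)
    then show ?thesis by (auto simp: depth_E mark_def)
  qed
qed

lemma distance_le_D:
  assumes "u \<in> V" "v \<in> V"
  shows "distance (T b) u v \<le> D"
\<comment> \<open>The route through the centre has length at most \<open>D\<close> unless the only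
  node of depth \<open>Suc L\<close> is counted twice.\<close>
proof (cases "u = v")
  case False
  have "distance (T b) u v \<le> depth u + depth v"
    using reach_root[of _ "up b" "dn b", folded T_def] assms
    by (intro distance_le reach_trans[OF reach_sym]) auto
  moreover have "2 * L \<le> D" using L_def by simp
  ultimately show ?thesis
    using depth_cases[OF assms(1)] depth_cases[OF assms(2)] False by auto
qed (use assms in simp)

lemma lipschitz_T:
  fixes g :: "nat \<Rightarrow> int"
  assumes "\<And>v. v \<in> V \<Longrightarrow> v \<noteq> R \<Longrightarrow> \<bar>g v - g (p v)\<bar> \<le> 1" "u \<in> V" "v \<in> V"
  shows "\<bar>g u - g v\<bar> \<le> int (distance (T b) u v)"
proof (rule reach_lipschitz)
  show "reach (T b) u (distance (T b) u v) v"
    using assms(2,3) by (intro is_tree_reach tree_T) simp_all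
  show "\<bar>g a - g c\<bar> \<le> 1" if "{a, c} \<in> edges (T b)" for a c
    using that assms(1)[of a] assms(1)[of c] by (auto simp: edge_T abs_minus_commute)
qed

lemma diameter_T: "diameter (T b) = D"
  unfolding diameter_def
proof (rule Max_eqI)
  have "{distance (T b) u v |u v. u \<in> nodes (T b) \<and> v \<in> nodes (T b)} =
      (\<lambda>(u, v). distance (T b) u v) ` (V \<times> V)" by auto
  then show "finite {distance (T b) u v |u v. u \<in> nodes (T b) \<and> v \<in> nodes (T b)}"
    using finite_V by simp
  show "d \<le> D" if "d \<in> {distance (T b) u v |u v. u \<in> nodes (T b) \<and> v \<in> nodes (T b)}" for d
    using that distance_le_D by auto
  \<comment> \<open>Signed depth: arm 0 counts upwards and all other arms downwards, so the ends of
    arms 0 and 1 differ by \<open>D\<close>.\<close>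
  define g where "g x = (if arm x = 0 then int (depth x) else - int (depth x))" for x
  have g: "\<bar>g v - g (p v)\<bar> \<le> 1" if "v \<in> V" "v \<noteq> R" for v
    using that
  proof (cases rule: V_cases)
    case (arm j i)
    then show ?thesis by (auto simp: g_def arm_E depth_E)
  next
    case (hang j i s)
    then show ?thesis using mark_pos[OF hang(3)] by (auto simp: g_def arm_E depth_E)
  qed
  have n: "E 0 (len 0) 0 \<in> V" "E 1 (len 1) 0 \<in> V" using V_arm K by auto
  have "\<bar>g (E 0 (len 0) 0) - g (E 1 (len 1) 0)\<bar> = int D"
  proof -
    have "len 0 = D - L" "len 1 = L" by (simp_all add: len_def)
    then show ?thesis using room D_cases by (auto simp: g_def arm_E depth_E)
  qed
  then have "D \<le> distance (T b) (E 0 (len 0) 0) (E 1 (len 1) 0)"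
    using lipschitz_T[of g, OF g n, of b] by simp
  then have "D = distance (T b) (E 0 (len 0) 0) (E 1 (len 1) 0)"
    using distance_le_D[OF n, of b] by simp
  then show "D \<in> {distance (T b) u v |u v. u \<in> nodes (T b) \<and> v \<in> nodes (T b)}"
    using n by auto
qed

lemma card_V_ge: "3 * K * L \<le> card V"
proof -
  let ?f = "\<lambda>(j, i). E j i 0"
  have "inj_on ?f ({..<3 * K} \<times> {1..L})"
    by (rule inj_onI) (auto simp: E_eq)
  moreover have "i \<le> len j" if "i \<le> L" for i j
    using that L_len(1)[of j] by simp
  then have "?f ` ({..<3 * K} \<times> {1..L}) \<subseteq> V"
    using V_arm by auto
  ultimately have "card ({..<3 * K} \<times> {1..L}) \<le> card V"
    by (rule card_inj_on_le[OF _ _ finite_V])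
  then show ?thesis by simp
qed

text \<open>An arm carries at most \<open>L div l\<close> hanging paths with \<open>l\<close>
  further nodes each, hence at most \<open>L\<close> such nodes.\<close>

lemma card_V_le: "card V \<le> 1 + 3 * K * (2 * L + 1)"
proof -
  let ?A = "(\<lambda>(j, i). E j i 0) ` ({..<3 * K} \<times> {1..Suc L})"
  let ?H = "(\<lambda>(j, q, s). E j (l * q) s) ` ({..<3 * K} \<times> {1..L div l} \<times> {1..l})"
  have "V \<subseteq> {R} \<union> ?A \<union> ?H"
  proof
    fix x assume x: "x \<in> V"
    show "x \<in> {R} \<union> ?A \<union> ?H"
    proof (cases "x = R")
      case False
      from x False show ?thesis
      proof (cases rule: V_cases)
        case (arm j i)
        then have "(j, Suc i) \<in> {..<3 * K} \<times> {1..Suc L}" using L_len(2)[of j] by simp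
        then show ?thesis using arm(1) by force
      next
        case (hang j i s)
        then obtain q where q: "i = l * q" by (auto simp: mark_def)
        have "q \<le> L div l"
          using hang(3) l2 by (simp add: mark_def q less_eq_div_iff_mult_less_eq mult.commute)
        then have "(j, q, Suc s) \<in> {..<3 * K} \<times> {1..L div l} \<times> {1..l}"
          using hang mark_pos[OF hang(3)] q by auto
        then show ?thesis using hang(1) q by force
      qed
    qed simp
  qed
  then have "card V \<le> card ({R} \<union> ?A \<union> ?H)" by (intro card_mono) auto
  also have "\<dots> \<le> card {R} + card ?A + card ?H"
    using card_Un_le[of "{R} \<union> ?A" ?H] card_Un_le[of "{R}" ?A] by linarith
  also have "card ?A \<le> 3 * K * Suc L"
    using card_image_le[of "{..<3 * K} \<times> {1..Suc L}" "\<lambda>(j, i). E j i 0"] by simp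
  also have "card ?H \<le> 3 * K * (L div l * l)"
    using card_image_le[of "{..<3 * K} \<times> {1..L div l} \<times> {1..l}" "\<lambda>(j, q, s). E j (l * q) s"]
    by (simp add: mult.assoc)
  also have "3 * K * (L div l * l) \<le> 3 * K * L" by (intro mult_left_mono) simp_all
  finally show ?thesis by (simp add: algebra_simps)
qed

section \<open>Identifiers make the views distinct\<close>

lemma ident_less: "j < 3 * K \<Longrightarrow> i \<le> L \<Longrightarrow> ident j i < 2 ^ l"
  using id_bound by (simp add: ident_def)

lemma ident_inj:
  assumes "ident j i = ident j' i'" "i \<le> L" "i' \<le> L"
  shows "j = j' \<and> i = i'"
proof -
  have e: "j * (L + 2) + i = j' * (L + 2) + i'" using assms(1) by (simp add: ident_def)
  have "(j * (L + 2) + i) div (L + 2) = j" "(j' * (L + 2) + i') div (L + 2) = j'"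
    using assms(2,3) by (simp_all del: mult_Suc_right add_2_eq_Suc')
  then have "j = j'" using e by simp
  then show ?thesis using e by simp
qed

text \<open>The bits that a hanging path spells suffice: bit 0 is always clear, and the bits above
  \<open>l\<close> vanish by the size bound.\<close>

lemma ident_bits:
  assumes "j < 3 * K" "i \<le> L" "j' < 3 * K" "i' \<le> L"
    and b: "\<And>s. 1 \<le> s \<Longrightarrow> s \<le> l \<Longrightarrow> bit (ident j i) s \<longleftrightarrow> bit (ident j' i') s"
  shows "j = j' \<and> i = i'"
proof -
  have hi: "\<not> bit x s" if "x < 2 ^ l" "l < s" for x s :: nat
  proof -
    have "(2::nat) ^ l \<le> 2 ^ s" using that(2) by (intro power_increasing) auto
    with that(1) have "x < 2 ^ s" by (rule order.strict_trans2)
    then show ?thesis by (simp add: bit_iff_odd)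
  qed
  have "bit (ident j i) s \<longleftrightarrow> bit (ident j' i') s" for s
  proof -
    consider "s = 0" | "1 \<le> s" "s \<le> l" | "l < s" by linarith
    then show ?thesis
    proof cases
      case 1
      then show ?thesis by (simp add: bit_0 ident_def)
    next
      case 3
      then show ?thesis using hi ident_less assms by blast
    qed (rule b)
  qed
  then have "ident j i = ident j' i'" by (simp add: bit_eq_iff)
  then show ?thesis using ident_inj assms by blast
qed

lemma bit1_ident: "bit (ident j i) 1"
  by (simp add: bit_iff_odd ident_def)

lemma near_mark:
  assumes "i \<le> Suc L"
  shows "\<exists>m. mark m \<and> m \<le> i + 2 * l \<and> i \<le> m + 2 * l"
proof (cases "i < l")
  case True
  have "mark l" using room radius l2 by (simp add: mark_def)
  then show ?thesis using True by (intro exI[of _ l]) simp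
next
  case False
  \<comment> \<open>Marks end at \<open>L - l\<close>, so \<open>i\<close> is first cut down to that
    bound, which costs at most \<open>l + 1\<close>, and then rounded down to a multiple of
    \<open>l\<close>, which costs less than \<open>l\<close>.\<close>
  define z where "z = min i (L - l)"
  have z: "l \<le> z" using False room radius by (simp add: z_def)
  define q where "q = z div l"
  have q: "l * q \<le> z" "z < l * q + l"
    using dividend_less_times_div[of l z] l2 by (simp_all add: q_def add.commute)
  have "0 < q" using z l2 by (simp add: q_def div_greater_zero_iff)
  then have "mark (l * q)"
    using q(1) l2 room radius by (auto simp: mark_def z_def)
  moreover have "i \<le> z + l + 1" using assms room radius by (simp add: z_def)
  ultimately show ?thesis
    using q by (intro exI[of _ "l * q"]) (auto simp: z_def)
qed

lemma rooted_tree_T: "b \<subseteq> free \<Longrightarrow> rooted_tree (T b) R"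
  by unfold_locales (simp_all add: port_numbered_T R_V)

lemma port_inj_T:
  assumes "b \<subseteq> free" "{u, v} \<in> edges (T b)" "{u, w} \<in> edges (T b)"
    "port (T b) u v = port (T b) u w"
  shows "v = w"
proof -
  interpret G: rooted_tree "T b" R by (rule rooted_tree_T[OF assms(1)])
  show ?thesis using G.port_inj assms(2-4) by blast
qed

text \<open>A port-preserving embedding of a part \<open>B\<close> of the tree into the same tree.
  In \<open>views_distinct\<close>, \<open>B\<close> is the ball that a view shows.\<close>

context
  fixes b :: "(nat \<times> nat) set" and B :: "nat set" and \<phi> :: "nat \<Rightarrow> nat"
  assumes b: "b \<subseteq> free" and BV: "B \<subseteq> V" and \<phi>V: "\<And>u. u \<in> B \<Longrightarrow> \<phi> u \<in> V"
    and inj: "inj_on \<phi> B"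
    and \<phi>_edge: "\<And>u v. u \<in> B \<Longrightarrow> v \<in> B \<Longrightarrow> {u, v} \<in> edges (T b) \<Longrightarrow> {\<phi> u, \<phi> v} \<in> edges (T b)"
    and \<phi>_port: "\<And>u v. u \<in> B \<Longrightarrow> v \<in> B \<Longrightarrow> {u, v} \<in> edges (T b) \<Longrightarrow>
      port (T b) (\<phi> u) (\<phi> v) = port (T b) u v"
begin

lemma fixed_step:
  assumes "u \<in> B" "v \<in> B" "{u, v} \<in> edges (T b)" "\<phi> u = u"
  shows "\<phi> v = v"
  using port_inj_T[OF b, of u "\<phi> v" v] \<phi>_edge[OF assms(1-3)] \<phi>_port[OF assms(1-3)] assms by simp

text \<open>The first edge of a hanging path, with port 2 above and 1 below, can only be mapped to
  such an edge. Injectivity forbids turning back, so the image runs down a hanging path as well; it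
  spells the same identifier and is therefore the same path.\<close>

lemma hang_fixed:
  assumes j: "j < 3 * K" and m: "mark m" and B: "\<And>s. s \<le> l \<Longrightarrow> E j m s \<in> B"
  shows "s \<le> l \<Longrightarrow> \<phi> (E j m s) = E j m s"
proof -
  note m0 = mark_pos[OF m]
  have e: "{E j m s, E j m (Suc s)} \<in> edges (T b)" if "s < l" for s
    by (rule edge_hang[OF j m that])
  have e': "{E j m (Suc s), E j m s} \<in> edges (T b)" if "s < l" for s
    using e[OF that] by (simp add: insert_commute)
  have E: "{\<phi> (E j m s), \<phi> (E j m (Suc s))} \<in> edges (T b)" if "s < l" for s
    using \<phi>_edge e[OF that] B that by simp
  have dn: "port (T b) (\<phi> (E j m s)) (\<phi> (E j m (Suc s))) = (if s = 0 then 2 else 1 - U b j m s)"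
    if "s < l" for s
    using \<phi>_port[OF B B e[OF that]] that ports_hang_down[OF j m that, of b] by simp
  have up: "port (T b) (\<phi> (E j m (Suc s))) (\<phi> (E j m s)) = U b j m (Suc s)" if "s < l" for s
    using \<phi>_port[OF B B e'[OF that]] that ports_hang[OF j m that, of b] by simp
  define z z1 where "z = \<phi> (E j m 0)" and "z1 = \<phi> (E j m 1)"
  have l0: "0 < l" using l2 by simp
  have zz: "{z, z1} \<in> edges (T b)" "port (T b) z z1 = 2" "port (T b) z1 z = U b j m 1"
    using E[OF l0] dn[OF l0] up[OF l0] by (simp_all add: z_def z1_def)
  have U1: "U b j m 1 = 1" using bit1_ident by (simp add: U_def)
  \<comment> \<open>Ports towards the centre are at most 1, so port 2 at \<open>z\<close> makes
    \<open>z\<close> the parent of \<open>z1\<close>.\<close>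
  have "\<not> (z \<in> V \<and> z \<noteq> R \<and> z1 = p z)"
    using port_T_up[of z b] up_le[of b z] zz(2) by auto
  then have z1: "z1 \<in> V" "z1 \<noteq> R" "z = p z1" using zz(1) by (auto simp: edge_T)
  have "\<exists>j' m'. z = E j' m' 0 \<and> z1 = E j' m' 1 \<and> j' < 3 * K \<and> mark m'"
    using z1(1,2)
  proof (cases rule: V_cases)
    case (arm j' i)
    have d: "(if i = 0 then j' else 1 - U b j' i 0) = 2"
      using ports_arm_down[OF arm(2,3), of b] zz(2) z1(3) arm(1,4) by simp
    \<comment> \<open>What remains is port 2 of the centre. The arm behind it has port 0 at position
      1, whereas bit 1 of an identifier is set.\<close>
    then have "i = 0" by (simp split: if_splits)
    then have "U b j' 1 0 = 1" using ports_arm[OF arm(2,3), of b] zz(3) z1(3) arm(1,4) U1 by simp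
    moreover have "(j' mod K, 1) \<notin> b" using b by (auto simp: free_def)
    ultimately show ?thesis by (simp add: U_def)
  next
    case (hang j' i s)
    have d: "(if s = 0 then 2 else 1 - U b j' i s) = 2"
      using ports_hang_down[OF hang(2-4), of b] zz(2) z1(3) hang(1,5) by simp
    then have "s = 0" by (simp split: if_splits)
    then show ?thesis using hang z1(3) by auto
  qed
  then obtain j' m' where jm: "z = E j' m' 0" "z1 = E j' m' 1" "j' < 3 * K" "mark m'" by blast
  note m0' = mark_pos[OF jm(4)]
  have step: "\<phi> (E j m s) = E j' m' s \<and> \<phi> (E j m (Suc s)) = E j' m' (Suc s)" if "s < l" for s
    using that
  proof (induction s)
    case 0
    then show ?case using jm by (simp add: z_def z1_def)
  next
    case (Suc s)
    let ?w = "\<phi> (E j m (Suc (Suc s)))"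
    have IH: "\<phi> (E j m s) = E j' m' s" "\<phi> (E j m (Suc s)) = E j' m' (Suc s)"
      using Suc by auto
    have "?w \<in> neighbours (T b) (E j' m' (Suc s))"
      using E[OF Suc.prems] IH by (simp add: neighbours_def)
    moreover have "?w \<noteq> E j' m' s"
    proof
      assume "?w = E j' m' s"
      then have "E j m (Suc (Suc s)) = E j m s"
        using inj_onD[OF inj, of "E j m (Suc (Suc s))" "E j m s"] B Suc.prems IH by simp
      then show False using m0 by (simp add: E_eq)
    qed
    ultimately show ?case
      using neighbours_hang[OF jm(3,4), of s b] Suc.prems IH by (auto split: if_splits)
  qed
  have bits: "bit (ident j m) s \<longleftrightarrow> bit (ident j' m') s" if s: "1 \<le> s" "s \<le> l" for s
  proof -
    obtain s' where s': "s = Suc s'" using s(1) by (cases s) auto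
    have "U b j' m' s = U b j m s"
      using up[of s'] step[of s'] ports_hang[OF jm(3,4), of s' b] s(2) s' by simp
    then show ?thesis using s' by (auto simp: U_def of_bool_def split: if_splits)
  qed
  have "j = j' \<and> m = m'"
    by (rule ident_bits[OF j _ jm(3) _ bits]) (use m jm(4) in \<open>simp_all add: mark_def\<close>)
  then have fx: "\<phi> (E j m 0) = E j m 0" "s < l \<Longrightarrow> \<phi> (E j m (Suc s)) = E j m (Suc s)" for s
    using step[OF l0] step by auto
  show "s \<le> l \<Longrightarrow> \<phi> (E j m s) = E j m s"
    using fx by (cases s) auto
qed

lemma arm_fixed:
  assumes j: "j < 3 * K" and fx: "\<phi> (E j m 0) = E j m 0"
    and le: "m \<le> len j" "i \<le> len j"
    and B: "\<And>k. k \<le> len j \<Longrightarrow> min i m \<le> k \<Longrightarrow> k \<le> max i m \<Longrightarrow> E j k 0 \<in> B"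
  shows "\<phi> (E j i 0) = E j i 0"
proof (cases "m \<le> i")
  case True
  have "m + d \<le> i \<Longrightarrow> \<phi> (E j (m + d) 0) = E j (m + d) 0" for d
  proof (induction d)
    case (Suc d)
    then show ?case
      using fixed_step[OF B B, of "m + d" "Suc (m + d)"] edge_arm[OF j, of "m + d" b] le by simp
  qed (simp add: fx)
  from this[of "i - m"] show ?thesis using True by simp
next
  case False
  have "d \<le> m - i \<Longrightarrow> \<phi> (E j (m - d) 0) = E j (m - d) 0" for d
  proof (induction d)
    case (Suc d)
    have s: "Suc (m - Suc d) = m - d" using Suc.prems by simp
    have "{E j (m - d) 0, E j (m - Suc d) 0} \<in> edges (T b)"
      using edge_arm[OF j, of "m - Suc d" b] Suc.prems le unfolding s by (simp add: insert_commute)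
    then show ?case
      using fixed_step[OF B B, of "m - d" "m - Suc d"] Suc le False by simp
  qed (simp add: fx)
  from this[of "m - i"] show ?thesis using False by simp
qed

end

text \<open>The ball of radius \<open>t\<close> contains a whole hanging path, either that of
  \<open>x\<close> itself or one starting on its arm within distance \<open>2 * l\<close>. Every
  isomorphism of views fixes that path, and since ports determine neighbours, fixedness spreads
  along the arm to \<open>x\<close>.\<close>

lemma views_distinct:
  assumes b: "b \<subseteq> free" and x: "x \<in> V" and y: "y \<in> V"
    and eq: "view (T b) x t = view (T b) y t"
  shows "x = y"
proof -
  define B where "B = {u \<in> V. distance (T b) x u \<le> t}"
  have xn: "x \<in> nodes (T b)" and yn: "y \<in> nodes (T b)" using x y by simp_all
  obtain \<phi> where bij: "bij_betw \<phi> (nodes (local_view (T b) x t)) (nodes (local_view (T b) y t))"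
    and rt: "\<phi> x = y"
    and ed: "\<And>u v. u \<in> B \<Longrightarrow> v \<in> B \<Longrightarrow> {u, v} \<in> edges (T b) \<Longrightarrow>
        {\<phi> u, \<phi> v} \<in> edges (T b) \<and> port (T b) (\<phi> u) (\<phi> v) = port (T b) u v"
    using eq unfolding view_eq_iff[OF xn yn] view_iso_def
    by (auto simp: local_view_def Let_def B_def)
  have A: "B \<subseteq> V" "\<And>u. u \<in> B \<Longrightarrow> \<phi> u \<in> V" "inj_on \<phi> B"
    "\<And>u v. u \<in> B \<Longrightarrow> v \<in> B \<Longrightarrow> {u, v} \<in> edges (T b) \<Longrightarrow> {\<phi> u, \<phi> v} \<in> edges (T b)"
    "\<And>u v. u \<in> B \<Longrightarrow> v \<in> B \<Longrightarrow> {u, v} \<in> edges (T b) \<Longrightarrow>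
      port (T b) (\<phi> u) (\<phi> v) = port (T b) u v"
    using bij ed by (auto simp: bij_betw_def local_view_def Let_def B_def)
  have ball: "u \<in> B" if "u \<in> V" "distance (T b) x u \<le> t" for u
    using that by (simp add: B_def)
  obtain j i s where xE: "x = E j i s" "valid j i s" using x by (auto simp: V_def)
  have j: "j < 3 * K" using xE(2) by (simp add: valid_def)
  have "\<phi> x = x"
  proof (cases "s = 0")
    case False
    then have i: "mark i" and s: "s \<le> l" using xE(2) by (auto simp: valid_def)
    have "E j i s' \<in> B" if s': "s' \<le> l" for s'
    proof (rule ball)
      show "E j i s' \<in> V" using V_hang[OF j i s'] .
      have "reach (T b) x (s + s') (E j i s')"
        unfolding xE(1) by (rule reach_trans[OF reach_sym[OF reach_hang[OF j i s]] reach_hang[OF j i s']])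
      then show "distance (T b) x (E j i s') \<le> t"
        using distance_le radius s s' by fastforce
    qed
    from hang_fixed[OF b A j i this s] show ?thesis by (simp add: xE(1))
  next
    case True
    have i: "i \<le> len j" using xE(2) True mark_less[of i j] by (auto simp: valid_def)
    obtain m where m: "mark m" "m \<le> i + 2 * l" "i \<le> m + 2 * l"
      using near_mark[of i] i L_len(2)[of j] by auto
    have ml: "m \<le> len j" using mark_less[OF m(1), of j] by simp
    have "E j m s' \<in> B" if s': "s' \<le> l" for s'
    proof (rule ball)
      show V': "E j m s' \<in> V" using V_hang[OF j m(1) s'] .
      have "distance (T b) x (E j m s') \<le>
          distance (T b) x (E j m 0) + distance (T b) (E j m 0) (E j m s')"
        using distance_triangle[OF tree_T[of b], of x "E j m 0" "E j m s'"] x V' V_arm[OF j ml]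
        by simp
      also have "distance (T b) x (E j m 0) \<le> 2 * l"
        using distance_arm[OF j i ml m(2,3), of b] True by (simp add: xE(1))
      also have "distance (T b) (E j m 0) (E j m s') \<le> s'"
        by (rule distance_le[OF reach_hang[OF j m(1) s']])
      finally show "distance (T b) x (E j m s') \<le> t" using radius s' by simp
    qed
    from hang_fixed[OF b A j m(1) this, of 0] have "\<phi> (E j m 0) = E j m 0" by simp
    moreover have "E j k 0 \<in> B" if "k \<le> len j" "min i m \<le> k" "k \<le> max i m" for k
    proof (rule ball)
      show "E j k 0 \<in> V" using V_arm[OF j that(1)] .
      have "k \<le> i + 2 * l" "i \<le> k + 2 * l" using that m by auto
      then show "distance (T b) x (E j k 0) \<le> t"
        using distance_arm[OF j i that(1), of "2 * l" b] True radius by (simp add: xE(1))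
    qed
    ultimately show ?thesis
      using arm_fixed[OF b A j _ ml i] True by (simp add: xE(1))
  qed
  then show ?thesis using rt by simp
qed

text \<open>When all views differ, a node that knows the map also knows its position, and outputs
  its route to the centre.\<close>

lemma xi_T:
  assumes "b \<subseteq> free"
  shows "xi (T b) \<le> enat t"
proof -
  define P where "P v = map (\<lambda>k. up b ((p ^^ k) v)) [0..<depth v]" for v
  define f where "f W = P (SOME v. v \<in> V \<and> view (T b) v t = W)" for W
  have f: "f (view (T b) v t) = P v" if "v \<in> V" for v
  proof -
    have "(SOME w. w \<in> V \<and> view (T b) w t = view (T b) v t) = v"
      by (rule some_equality) (use that views_distinct[OF assms] in auto)
    then show ?thesis by (simp add: f_def)
  qed
  have "elects_leader (T b) P"
    using elects_leader_root[of "up b" "dn b"] unfolding T_def P_def .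
  then have "elects_leader (T b) (\<lambda>v. f (view (T b) v t))"
    using f by (simp add: elects_leader_def)
  then show ?thesis unfolding xi_def by (intro Inf_lower) blast
qed

end

section \<open>The lower bound\<close>

lemma card_bool_lists_less: "card {xs :: bool list. length xs < N} < 2 ^ N"
proof (induction N)
  case (Suc N)
  have "{xs :: bool list. length xs < Suc N} =
      {xs. length xs < N} \<union> {xs. set xs \<subseteq> UNIV \<and> length xs = N}" by auto
  then have "card {xs :: bool list. length xs < Suc N} \<le>
      card {xs :: bool list. length xs < N} + 2 ^ N"
    using card_Un_le[of "{xs :: bool list. length xs < N}" "{xs. set xs \<subseteq> UNIV \<and> length xs = N}"]
      card_lists_length_eq[of "UNIV :: bool set" N]
    by simp
  then show ?case using Suc by simp
qed simp

lemma finite_bool_lists_less: "finite {xs :: bool list. length xs < N}"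
  using finite_lists_length_le[of "UNIV :: bool set" N]
  by (rule rev_finite_subset) auto

lemma halts_at_cong:
  assumes "halts_at alg a S v r" "halts_at alg a S' v' r'"
    and "\<And>s. s \<le> max r r' \<Longrightarrow> view S v s = view S' v' s"
  shows "r = r'"
proof -
  have "\<not> r < r'" "\<not> r' < r"
    using assms(1,2) assms(3)[of r] assms(3)[of r'] by (auto simp: halts_at_def)
  then show ?thesis by simp
qed

context spider
begin

section \<open>What the end of an arm sees and what it must output\<close>

lemma edges_T: "edges (T b) = (\<lambda>v. {v, p v}) ` (V - {R})"
  by (simp add: T_def parent_tree_def)

lemma distance_T_cong: "distance (T b) u v = distance (T b') u v"
  by (simp add: distance_def walk_def edges_T)

lemma degree_T_cong: "degree (T b) u = degree (T b') u"
  by (simp add: degree_def neighbours_def edges_T)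

lemma up_far:
  assumes "b \<subseteq> free" "b' \<subseteq> free" "M + 2 \<le> pos x"
  shows "up b x = up b' x"
proof -
  obtain j i s :: nat where x: "from_nat x = (j, i, s)" by (metis prod_cases3)
  have i: "M + 2 \<le> i" using assms(3) x by (simp add: pos_def)
  have "U b j i s = U b' j i s"
  proof (cases "s = 0")
    case True
    then show ?thesis using U_far[OF assms(1) i, of j] U_far[OF assms(2) i, of j] by simp
  qed (simp add: U_def)
  then show ?thesis by (simp add: up_def x)
qed

lemma dn_far:
  assumes "b \<subseteq> free" "b' \<subseteq> free" "v \<in> V" "v \<noteq> R" "M + 2 \<le> pos (p v)"
  shows "port (T b) (p v) v = port (T b') (p v) v"
  using assms(3,4)
proof (cases rule: V_cases)
  case (arm j i)
  then have "M + 2 \<le> i" using assms(5) by (simp add: pos_E)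
  then have "U b j i 0 = U b' j i 0"
    using U_far[OF assms(1), of i j] U_far[OF assms(2), of i j] by simp
  then show ?thesis
    using ports_arm_down[OF arm(2,3)] arm(1,4) by simp
next
  case (hang j i s)
  have "s \<noteq> 0 \<Longrightarrow> U b j i s = U b' j i s" by (simp add: U_def)
  then show ?thesis
    using ports_hang_down[OF hang(2-4)] hang(1,5) by simp
qed

text \<open>Positions change by at most 1 along edges, so by \<open>room\<close> the view stays at
  positions from \<open>M + 2\<close> on, where no port depends on the free bits. All radii up to
  \<open>t\<close> are covered because halting rounds have to be compared too.\<close>

lemma view_end_cong:
  assumes b: "b \<subseteq> free" "b' \<subseteq> free" and j: "j < 3 * K" and s: "s \<le> t"
  shows "view (T b) (E j (len j) 0) s = view (T b') (E j (len j) 0) s"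
proof -
  let ?v = "E j (len j) 0"
  have v: "?v \<in> V" using V_arm[OF j] by simp
  have far: "M + 2 \<le> pos u" if u: "u \<in> V" "distance (T b) ?v u \<le> s" for u
  proof -
    have "\<bar>int (pos v) - int (pos (p v))\<bar> \<le> 1" if "v \<in> V" "v \<noteq> R" for v
      using that by (cases rule: V_cases) (auto simp: pos_E)
    then have "\<bar>int (pos ?v) - int (pos u)\<bar> \<le> int (distance (T b) ?v u)"
      using lipschitz_T[of "\<lambda>x. int (pos x)" ?v u b] v u(1) by blast
    then show ?thesis using u(2) s room L_len(1)[of j] by (simp add: pos_E)
  qed
  have port: "port (T b') u w = port (T b) u w"
    if e: "{u, w} \<in> edges (T b)" and u: "u \<in> V" "distance (T b) ?v u \<le> s" for u w
  proof -
    consider "u \<noteq> R" "w = p u" | "w \<in> V" "w \<noteq> R" "u = p w" using e by (auto simp: edge_T)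
    then show ?thesis
    proof cases
      case 1
      then show ?thesis
        using up_far[OF b far[OF u]] port_T_up[OF u(1), of b] port_T_up[OF u(1), of b'] by simp
    next
      case 2
      then show ?thesis using dn_far[OF b 2(1,2)] far[OF u] by simp
    qed
  qed
  have n: "?v \<in> nodes (T b)" "?v \<in> nodes (T b')" using v by simp_all
  show ?thesis
    unfolding view_eq_iff[OF n] view_iso_def
    by (rule exI[of _ id])
       (use port in \<open>auto simp: local_view_def Let_def distance_T_cong[of b' _ _ b]
          degree_T_cong[of b' _ b] edges_T\<close>)
qed

text \<open>Without the centre the arms are disjoint, and a leader at the centre lies outside all of
  them.\<close>

definition Arm :: "nat \<Rightarrow> nat set" where
  "Arm j = {E j i s | i s. 0 < i}"

lemma Arm_disjoint: "x \<in> Arm j \<Longrightarrow> x \<in> Arm j' \<Longrightarrow> j = j'"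
  by (auto simp: Arm_def E_eq)

text \<open>On its way out of the arm the path cannot turn back outwards without repeating a node,
  and hanging paths are dead ends.\<close>

lemma simple_path_arm:
  assumes xs: "simple_path (T b) xs" "hd xs = E j (len j) 0" and j: "j < 3 * K"
    and out: "last xs \<notin> Arm j"
  shows "k \<le> len j \<Longrightarrow> k < length xs \<and> xs ! k = E j (len j - k) 0"
proof (induction k rule: less_induct)
  case (less k)
  have dist: "distinct xs" and ne: "xs \<noteq> []"
    and se: "\<And>i. Suc i < length xs \<Longrightarrow> {xs ! i, xs ! Suc i} \<in> edges (T b)"
    using xs(1) by (auto simp: simple_path_def walk_def)
  show ?case
  proof (cases k)
    case 0
    then show ?thesis using xs(2) ne by (simp add: hd_conv_nth)
  next
    case (Suc n)
    have IH: "n < length xs" "xs ! n = E j (len j - n) 0" using less Suc by auto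
    define i where "i = len j - Suc n"
    have i: "len j - n = Suc i" "Suc i \<le> len j" using less.prems Suc by (auto simp: i_def)
    have "last xs \<noteq> xs ! n" using out IH i by (auto simp: Arm_def)
    then have "n \<noteq> length xs - 1" using ne by (auto simp: last_conv_nth)
    then have len: "Suc n < length xs" using IH(1) by simp
    have "xs ! Suc n \<in> neighbours (T b) (E j (Suc i) 0)"
      using se[OF len] IH(2) i by (simp add: neighbours_def)
    then consider "xs ! Suc n = E j i 0"
      | "Suc i < len j" "xs ! Suc n = E j (Suc (Suc i)) 0"
      | "mark (Suc i)" "xs ! Suc n = E j (Suc i) 1"
      unfolding neighbours_arm[OF j i(2)] by (auto split: if_splits)
    then have "xs ! Suc n = E j i 0"
    proof cases
      case 2
      then obtain n' where n': "n = Suc n'" using i by (cases n) auto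
      have "xs ! n' = E j (len j - n') 0" using less.IH[of n'] less.prems Suc n' by simp
      moreover have "len j - n' = Suc (Suc i)" using i n' by simp
      ultimately have "xs ! n' = xs ! Suc n" using 2 by simp
      then show ?thesis using dist len n' by (simp add: nth_eq_iff_index_eq)
    next
      case 3
      \<comment> \<open>Once on a hanging path, a simple path stays there, since the only exit is
        the node \<open>xs ! n\<close> already visited. It would then end inside the arm.\<close>
      have stay: "Suc n + d < length xs \<Longrightarrow> \<exists>s. 1 \<le> s \<and> s \<le> l \<and> xs ! (Suc n + d) = E j (Suc i) s" for d
      proof (induction d)
        case 0
        then show ?case using 3 l2 by (intro exI[of _ 1]) simp
      next
        case (Suc d)
        then obtain s where s: "1 \<le> s" "s \<le> l" "xs ! (Suc n + d) = E j (Suc i) s" by auto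
        obtain s' where s': "s = Suc s'" using s(1) by (cases s) auto
        have l': "s' < l" using s s' by simp
        have "xs ! (Suc n + Suc d) \<in> neighbours (T b) (E j (Suc i) (Suc s'))"
          using se[of "Suc n + d"] Suc.prems s s' by (simp add: neighbours_def)
        then consider "xs ! (Suc n + Suc d) = E j (Suc i) s'"
          | "Suc s' < l" "xs ! (Suc n + Suc d) = E j (Suc i) (Suc (Suc s'))"
          unfolding neighbours_hang[OF j 3(1) l'] by (auto split: if_splits)
        then show ?case
        proof cases
          case 1
          have "s' \<noteq> 0"
          proof
            assume "s' = 0"
            then have "xs ! (Suc n + Suc d) = xs ! n" using 1 IH(2) i by simp
            then show False using dist Suc.prems IH(1) nth_eq_iff_index_eq[OF dist, of "Suc n + Suc d" n] by simp
          qed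
          then show ?thesis using 1 l' by (intro exI[of _ s']) simp
        next
          case 2
          then show ?thesis by (intro exI[of _ "Suc (Suc s')"]) simp
        qed
      qed
      have "last xs = xs ! (Suc n + (length xs - 1 - Suc n))"
        unfolding last_conv_nth[OF ne] using len by (intro arg_cong[of _ _ "(!) xs"]) simp
      moreover have "Suc n + (length xs - 1 - Suc n) < length xs" using len by simp
      ultimately have "\<exists>s. last xs = E j (Suc i) s" using stay by metis
      then have "last xs \<in> Arm j" by (auto simp: Arm_def)
      then show ?thesis using out by simp
    qed
    then show ?thesis using len Suc by (simp add: i_def)
  qed
qed

lemma follows_end_bit:
  assumes "follows (T b) (E j (len j) 0) ps xs" "simple_path (T b) xs" "last xs \<notin> Arm j"
    and j: "j < 3 * K" and i: "2 \<le> i" "i < M + 2"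
  shows "(j mod K, i) \<in> b \<longleftrightarrow> ps ! (len j - i) = 1"
proof -
  note A = simple_path_arm[OF assms(2) _ j assms(3)]
  have hd: "hd xs = E j (len j) 0" using assms(1) by (simp add: follows_def)
  have il: "i \<le> len j" using i room L_len(1)[of j] by simp
  obtain i' where i': "i = Suc i'" using i by (cases i) auto
  \<comment> \<open>The node at position \<open>i\<close> is reached after this many steps from the
    end, so its port is entry \<open>k\<close> of the output.\<close>
  define k where "k = len j - i"
  have k: "len j - k = i" "len j - Suc k = i'" "Suc k \<le> len j" using il i' i by (auto simp: k_def)
  have "xs ! k = E j i 0" "xs ! Suc k = E j i' 0" "Suc k < length xs"
    using A[OF hd, of k] A[OF hd, of "Suc k"] k by auto
  then have "U b j i 0 = ps ! k"
    using assms(1) ports_arm[OF j, of i' b] il i' by (auto simp: follows_def)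
  then show ?thesis by (auto simp: U_def k_def of_bool_def split: if_splits)
qed

text \<open>Each bit vector sits on three arms, so for two trees with the same advice one of these arms
  contains neither leader, and its end node outputs the bit vector in both trees.\<close>

lemma advice_inj:
  assumes alg: "elects_within alg A C t" and C: "\<And>b. b \<subseteq> free \<Longrightarrow> T b \<in> C"
    and b: "b \<subseteq> free" "b' \<subseteq> free" and eq: "A (T b) = A (T b')"
  shows "b = b'"
proof -
  have ex: "\<exists>h x. (\<forall>v\<in>V. halts_at alg (A (T b)) (T b) v (h v) \<and> h v \<le> t) \<and>
      (\<forall>v\<in>V. \<exists>xs. follows (T b) v (the (alg (view (T b) v (h v)) (A (T b)))) xs \<and>
        simple_path (T b) xs \<and> last xs = x)" if "b \<subseteq> free" for b
    using bspec[OF alg[unfolded elects_within_def] C[OF that]]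
    unfolding elects_leader_def nodes_T by blast
  obtain h x where h: "\<And>v. v \<in> V \<Longrightarrow> halts_at alg (A (T b)) (T b) v (h v) \<and> h v \<le> t"
    and x: "\<And>v. v \<in> V \<Longrightarrow> \<exists>xs. follows (T b) v (the (alg (view (T b) v (h v)) (A (T b)))) xs \<and>
        simple_path (T b) xs \<and> last xs = x"
    using ex[OF b(1)] by blast
  obtain h' x' where h': "\<And>v. v \<in> V \<Longrightarrow> halts_at alg (A (T b')) (T b') v (h' v) \<and> h' v \<le> t"
    and x': "\<And>v. v \<in> V \<Longrightarrow> \<exists>xs. follows (T b') v (the (alg (view (T b') v (h' v)) (A (T b')))) xs \<and>
        simple_path (T b') xs \<and> last xs = x'"
    using ex[OF b(2)] by blast
  have bit: "(q, i) \<in> b \<longleftrightarrow> (q, i) \<in> b'" if qi: "(q, i) \<in> free" for q i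
  proof -
    have q: "q < K" "2 \<le> i" "i < M + 2" using qi by (auto simp: free_def)
    have "\<exists>j\<in>{q, q + K, q + 2 * K}. x \<notin> Arm j \<and> x' \<notin> Arm j"
    proof (rule ccontr)
      assume "\<not> ?thesis"
      then have "x \<in> Arm j \<or> x' \<in> Arm j" if "j \<in> {q, q + K, q + 2 * K}" for j
        using that by blast
      from this[of q] this[of "q + K"] this[of "q + 2 * K"]
      have "q = q + K \<or> q = q + 2 * K \<or> q + K = q + 2 * K"
        using Arm_disjoint by blast
      then show False using K by simp
    qed
    then obtain j where j: "j \<in> {q, q + K, q + 2 * K}" "x \<notin> Arm j" "x' \<notin> Arm j" by blast
    have j3: "j < 3 * K" and jq: "j mod K = q" using j(1) q by auto
    let ?v = "E j (len j) 0"
    have v: "?v \<in> V" using V_arm[OF j3] by simp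
    \<comment> \<open>Equal advice and equal views in all rounds up to \<open>t\<close> force the
      same halting round, and only then the same output.\<close>
    have "h ?v = h' ?v"
      using h[OF v] h'[OF v] view_end_cong[OF b j3] eq
      by (intro halts_at_cong[of alg "A (T b)" "T b" ?v _ "T b'" ?v]) auto
    then have out: "the (alg (view (T b) ?v (h ?v)) (A (T b))) =
        the (alg (view (T b') ?v (h' ?v)) (A (T b')))"
      using view_end_cong[OF b j3, of "h' ?v"] h'[OF v] eq by simp
    obtain xs where "follows (T b) ?v (the (alg (view (T b) ?v (h ?v)) (A (T b)))) xs"
      "simple_path (T b) xs" "last xs = x"
      using x[OF v] by blast
    moreover obtain xs' where "follows (T b') ?v (the (alg (view (T b') ?v (h' ?v)) (A (T b')))) xs'"
      "simple_path (T b') xs'" "last xs' = x'"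
      using x'[OF v] by blast
    ultimately show ?thesis
      using follows_end_bit[OF _ _ _ j3 q(2,3)] j(2,3) out jq by metis
  qed
  show ?thesis
  proof (intro set_eqI)
    fix z show "z \<in> b \<longleftrightarrow> z \<in> b'"
      using bit b by (cases z) blast
  qed
qed

text \<open>Pigeonhole: \<open>2 ^ (K * M)\<close> bit vectors need distinct advice, and there are
  fewer strings shorter than \<open>K * M\<close>.\<close>

lemma long_advice:
  assumes "elects_within alg A C t" "\<And>b. b \<subseteq> free \<Longrightarrow> T b \<in> C"
  shows "\<exists>b\<subseteq>free. K * M \<le> length (A (T b))"
proof (rule ccontr)
  assume "\<not> ?thesis"
  then have "(\<lambda>b. A (T b)) ` Pow free \<subseteq> {xs. length xs < K * M}" by auto
  moreover have "inj_on (\<lambda>b. A (T b)) (Pow free)"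
    using advice_inj[OF assms] by (intro inj_onI) auto
  ultimately have "card (Pow free) \<le> card {xs :: bool list. length xs < K * M}"
    by (intro card_inj_on_le finite_bool_lists_less)
  also have "\<dots> < 2 ^ (K * M)" by (rule card_bool_lists_less)
  also have "card free = K * M" by (simp add: free_def card_cartesian_product)
  then have "2 ^ (K * M) = card (Pow free)" by (simp add: card_Pow free_def)
  finally show False by simp
qed

lemma min_advice_ge:
  assumes "\<And>b. b \<subseteq> free \<Longrightarrow> T b \<in> C"
  shows "enat (K * M) \<le> min_advice C t"
  unfolding min_advice_def
proof (rule Inf_greatest)
  fix z assume "z \<in> {SUP T\<in>C. enat (length (A T)) | alg A. elects_within alg A C t}"
  then obtain alg A where z: "z = (SUP T\<in>C. enat (length (A T)))" and e: "elects_within alg A C t"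
    by blast
  obtain b where b: "b \<subseteq> free" "K * M \<le> length (A (T b))"
    using long_advice[OF e assms] by blast
  have "enat (K * M) \<le> enat (length (A (T b)))" using b(2) by simp
  also have "\<dots> \<le> z" unfolding z by (rule SUP_upper[OF assms[OF b(1)]])
  finally show "enat (K * M) \<le> z" .
qed

end

section \<open>Asymptotics\<close>

text \<open>\<open>K\<close> is chosen so that \<open>K * D\<close> lies between \<open>n\<close>
  and \<open>2 * n\<close>. Identifiers then stay below \<open>24 * n\<close>, which the summand 7
  in \<open>l\<close> accommodates as \<open>24 \<le> 2 ^ 7\<close>. Rounding leaves
  \<open>M\<close> at least \<open>\<delta> / 4 * D\<close>, which gives the factor in the lower
  bound on \<open>K * M\<close>.\<close>

lemma spider_parameters:
  fixes \<alpha> \<delta> x :: real and n D :: nat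
  defines "x \<equiv> log 2 (real n)" and "\<delta> \<equiv> 1 / 2 - \<alpha>"
  assumes \<alpha>: "0 < \<alpha>" "\<alpha> < 1 / 2" and x: "8 \<le> x" and D: "2 / (\<alpha> * \<delta>) * x\<^sup>2 \<le> real D"
    and Dn: "D < n"
  shows "spider D (n div D + 1) (D div 2) (nat \<lceil>x\<rceil> + 7) (nat \<lfloor>\<delta> * real D / 2\<rfloor>)
    (nat \<lfloor>\<alpha> * real D\<rfloor>)" (is ?spider)
    and "\<delta> / 4 * real n \<le> real ((n div D + 1) * nat \<lfloor>\<delta> * real D / 2\<rfloor>)"
    and "3 \<le> D" and "n \<le> (n div D + 1) * D" and "(n div D + 1) * D \<le> 2 * n"
proof -
  have \<delta>: "0 < \<delta>" "\<delta> < 1 / 2" using \<alpha> by (auto simp: \<delta>_def)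
  have D': "2 * x\<^sup>2 \<le> real D * (\<alpha> * \<delta>)"
    using D \<alpha> \<delta> by (simp add: field_simps)
  \<comment> \<open>As \<open>\<alpha>\<close> and \<open>\<delta>\<close> are below 1,
    \<open>\<alpha> * D\<close> and \<open>\<delta> * D\<close> are each at least
    \<open>16 * x\<close>, hence at least 128.\<close>
  have "8 * x \<le> x\<^sup>2" using x by (simp add: power2_eq_square)
  then have "16 * x \<le> real D * (\<alpha> * \<delta>)" using D' by simp
  moreover have "real D * (\<alpha> * \<delta>) \<le> real D * \<alpha>" "real D * (\<alpha> * \<delta>) \<le> real D * \<delta>"
    using \<alpha> \<delta> by (auto intro!: mult_left_mono simp: mult_left_le mult_left_le_one_le)
  ultimately have \<alpha>D: "16 * x \<le> \<alpha> * real D" and \<delta>D: "128 \<le> \<delta> * real D"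
    using x by (auto simp: mult.commute)
  have "\<delta> * real D \<le> 1 * real D" using \<delta> by (intro mult_right_mono) auto
  then have D3: "128 \<le> D" using \<delta>D by simp
  then show "3 \<le> D" by simp
  define K where "K = n div D + 1"
  have KD: "n \<le> K * D" "K * D \<le> 2 * n"
  proof -
    have "n < n div D * D + D" using D3 dividend_less_div_times[of D n] by simp
    then show "n \<le> K * D" by (simp add: K_def)
    have "n div D * D \<le> n" by simp
    moreover have "K * D = n div D * D + D" by (simp add: K_def)
    ultimately show "K * D \<le> 2 * n" using Dn by linarith
  qed
  then show "n \<le> (n div D + 1) * D" and "(n div D + 1) * D \<le> 2 * n" by (simp_all add: K_def)
  define M where "M = nat \<lfloor>\<delta> * real D / 2\<rfloor>"
  define t where "t = nat \<lfloor>\<alpha> * real D\<rfloor>"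
  define l where "l = nat \<lceil>x\<rceil> + 7"
  have M: "real M \<le> \<delta> * real D / 2" "\<delta> * real D / 2 - 1 \<le> real M"
    using \<delta>D unfolding M_def by linarith+
  have t: "real t \<le> \<alpha> * real D" "\<alpha> * real D - 1 \<le> real t"
    using \<alpha>D x unfolding t_def by linarith+
  have l: "real l \<le> x + 8" "x + 7 \<le> real l" using x unfolding l_def by linarith+
  have n0: "0 < n" using Dn by simp
  have "2 powr x = real n" unfolding x_def using n0 by simp
  moreover have "2 powr x \<le> 2 powr real (nat \<lceil>x\<rceil>)" by (intro powr_mono) (use x in linarith)+
  ultimately have "real n \<le> 2 ^ nat \<lceil>x\<rceil>" by (simp add: powr_realpow)
  then have "real n \<le> real (2 ^ nat \<lceil>x\<rceil>)" by simp
  then have "n \<le> 2 ^ nat \<lceil>x\<rceil>" by (simp only: of_nat_le_iff)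
  then have nl: "24 * n \<le> 2 ^ l" by (simp add: l_def power_add)
  have "spider D K (D div 2) l M t"
  proof
    show "1 \<le> K" by (simp add: K_def)
    show "4 * l + 4 \<le> t"
    proof -
      have "real (4 * l + 4) \<le> real t" using l t \<alpha>D x by simp
      then show ?thesis by (simp only: of_nat_le_iff)
    qed
    show "M + 2 + t \<le> D div 2"
    proof -
      \<comment> \<open>The remaining \<open>\<delta> * D / 2\<close> is at least 64 and pays for
        the summand 2 and the rounding of \<open>D div 2\<close>.\<close>
      have "\<delta> * real D / 2 + \<alpha> * real D = real D / 2 - \<delta> * real D / 2"
        by (simp add: \<delta>_def algebra_simps)
      moreover have "real D \<le> 2 * real (D div 2) + 1" by linarith
      ultimately have "real (M + 2 + t) \<le> real (D div 2)" using M t \<delta>D by simp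
      then show ?thesis by (simp only: of_nat_le_iff)
    qed
    fix j i assume j: "j < 3 * K" and i: "i \<le> D div 2"
    have "j * (D div 2 + 2) + i < Suc j * (D div 2 + 2)" using i by simp
    also have "\<dots> \<le> 3 * K * (D div 2 + 2)" using j by (intro mult_right_mono) auto
    also have "\<dots> \<le> 3 * K * D" using D3 by (intro mult_left_mono) auto
    also have "3 * K * D \<le> 6 * n" using KD(2) unfolding mult.assoc by linarith
    finally show "4 * (j * (D div 2 + 2) + i) + 2 < 2 ^ l" using nl by simp
  qed simp
  then show ?spider by (simp add: K_def M_def t_def l_def)
  have "real n \<le> real (K * D)" using KD(1) by (simp only: of_nat_le_iff)
  then have "\<delta> / 4 * real n \<le> \<delta> / 4 * real (K * D)"
    using \<delta> by (intro mult_left_mono) simp_all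
  also have "\<dots> = real K * (\<delta> * real D / 4)" by simp
  also have "\<dots> \<le> real K * real M" using M \<delta>D by (intro mult_left_mono) auto
  finally show "\<delta> / 4 * real n \<le> real ((n div D + 1) * nat \<lfloor>\<delta> * real D / 2\<rfloor>)"
    by (simp only: K_def M_def of_nat_mult)
qed

text \<open>The size is at least \<open>3 * K * (D div 2)\<close>, hence at least
  \<open>K * D\<close> and \<open>n\<close>, and at most \<open>1 + 6 * (K * D)\<close>, hence at
  most \<open>20 * n\<close>. The code has 4 bits per node, whence the 80.\<close>

lemma min_advice_tree_class:
  fixes \<alpha> \<delta> :: real and n D :: nat
  defines "\<delta> \<equiv> 1 / 2 - \<alpha>" and "t \<equiv> nat \<lfloor>\<alpha> * real D\<rfloor>"
  assumes \<alpha>: "0 < \<alpha>" "\<alpha> < 1 / 2" and x: "8 \<le> log 2 (real n)"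
    and D: "2 / (\<alpha> * \<delta>) * (log 2 (real n))\<^sup>2 \<le> real D" and Dn: "D < n"
  shows "\<exists>m. min_advice (tree_class 1 20 n D t) t = enat m \<and>
    \<delta> / 4 * real n \<le> real m \<and> real m \<le> 80 * real n"
proof -
  define K where "K = n div D + 1"
  define M where "M = nat \<lfloor>\<delta> * real D / 2\<rfloor>"
  note par = spider_parameters[OF \<alpha> x D[unfolded \<delta>_def] Dn]
  have sp: "spider D K (D div 2) (nat \<lceil>log 2 (real n)\<rceil> + 7) M t"
    using par(1) unfolding K_def M_def t_def \<delta>_def .
  have KM: "\<delta> / 4 * real n \<le> real (K * M)"
    using par(2) unfolding K_def M_def \<delta>_def .
  have KD: "n \<le> K * D" "K * D \<le> 2 * n" using par(4,5) unfolding K_def .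
  interpret spider D K "D div 2" "nat \<lceil>log 2 (real n)\<rceil> + 7" M t by (rule sp)
  have "T b \<in> tree_class 1 20 n D t" if "b \<subseteq> free" for b
  proof -
    have "D \<le> 3 * (D div 2)" using par(3) by presburger
    then have "K * D \<le> K * (3 * (D div 2))" by (rule mult_left_mono) simp
    moreover have "K * (3 * (D div 2)) = 3 * K * (D div 2)" by simp
    ultimately have lo: "n \<le> card V" using card_V_ge KD(1) by linarith
    have "3 * K * (2 * (D div 2) + 1) \<le> 3 * K * (D + 1)" by (rule mult_left_mono) simp_all
    then have "card V \<le> 1 + 3 * K * (D + 1)" using card_V_le by linarith
    also have "\<dots> \<le> 1 + 6 * (K * D)" using par(3) by (simp add: algebra_simps)
    also have "\<dots> \<le> 20 * n" using KD(2) Dn by linarith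
    finally have hi: "card V \<le> 20 * n" .
    have "real (card V) \<le> 20 * real n" using hi by linarith
    then show ?thesis
      using that lo by (simp add: tree_class_def port_numbered_T diameter_T xi_T)
  qed
  then have lower: "enat (K * M) \<le> min_advice (tree_class 1 20 n D t) t"
    by (rule min_advice_ge)
  have upper: "min_advice (tree_class 1 20 n D t) t \<le> enat (4 * (20 * n))"
    by (rule min_advice_le) (auto simp: tree_class_def)
  then obtain m where m: "min_advice (tree_class 1 20 n D t) t = enat m"
    by (cases "min_advice (tree_class 1 20 n D t) t") auto
  have "K * M \<le> m" using lower unfolding m by simp
  then have "real (K * M) \<le> real m" by (simp only: of_nat_le_iff)
  then have "\<delta> / 4 * real n \<le> real m" using KM by simp
  moreover have "m \<le> 80 * n" using upper unfolding m by simp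
  then have "real m \<le> 80 * real n" by linarith
  ultimately show ?thesis using m by blast
qed

theorem corollary6p1:
  fixes \<alpha> :: real
  assumes "0 < \<alpha>" and "\<alpha> < 1 / 2"
  shows "\<exists>c1 c2 b1 b2 :: real. 0 < c1 \<and> c1 \<le> c2 \<and> 0 < b1 \<and> b1 \<le> b2 \<and>
    (\<forall>D :: nat \<Rightarrow> nat.
       (\<forall>\<^sub>F n in sequentially. 0 < D n \<and> D n < n) \<longrightarrow>
       (\<lambda>n. real (D n)) \<in> \<omega>(\<lambda>n. (log 2 (real n))\<^sup>2) \<longrightarrow>
       (\<forall>\<^sub>F n in sequentially.
          let \<tau> = nat \<lfloor>\<alpha> * real (D n)\<rfloor> in
          \<exists>m :: nat. min_advice (tree_class c1 c2 n (D n) \<tau>) \<tau> = enat m \<and>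
            b1 * real n \<le> real m \<and> real m \<le> b2 * real n))"
proof -
  define \<delta> where "\<delta> = 1 / 2 - \<alpha>"
  have \<delta>: "0 < \<delta>" "\<delta> < 1 / 2" using assms by (simp_all add: \<delta>_def)
  have main: "\<forall>\<^sub>F n in sequentially.
          let \<tau> = nat \<lfloor>\<alpha> * real (D n)\<rfloor> in
          \<exists>m :: nat. min_advice (tree_class 1 20 n (D n) \<tau>) \<tau> = enat m \<and>
            \<delta> / 4 * real n \<le> real m \<and> real m \<le> 80 * real n"
    if D: "\<forall>\<^sub>F n in sequentially. 0 < D n \<and> D n < n"
      and \<omega>: "(\<lambda>n. real (D n)) \<in> \<omega>(\<lambda>n. (log 2 (real n))\<^sup>2)" for D :: "nat \<Rightarrow> nat"
  proof -
    \<comment> \<open>The growth of \<open>D\<close> is instantiated at the constant of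
      \<open>min_advice_tree_class\<close>; the threshold 256 below is \<open>2 ^ 8\<close>, for the
      bound 8 on the logarithm.\<close>
    have "\<forall>\<^sub>F n in sequentially. 2 / (\<alpha> * \<delta>) * norm ((log 2 (real n))\<^sup>2) \<le> norm (real (D n))"
      using assms \<delta> by (intro landau_omega.smallD[OF \<omega>]) simp
    moreover have "\<forall>\<^sub>F n :: nat in sequentially. 256 \<le> n" by (rule eventually_ge_at_top)
    ultimately show ?thesis
      using D
    proof eventually_elim
      case (elim n)
      have "8 \<le> log 2 (real n)" using elim(2) by (subst le_log_iff) simp_all
      moreover have "2 / (\<alpha> * \<delta>) * (log 2 (real n))\<^sup>2 \<le> real (D n)" using elim(1) by simp
      ultimately show ?case
        using min_advice_tree_class[OF assms, of n "D n"] elim(3) by (simp add: Let_def \<delta>_def)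
    qed
  qed
  show ?thesis
    using main \<delta>
    by (intro exI[of _ 1] exI[of _ 20] exI[of _ "\<delta> / 4"] exI[of _ 80]) auto
qed

end
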